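(* Let $E$ be a self-affine Moran set with Moran construction $\{(n_k,m_k,\mathcal{D}_k)\}_{k\ge1}$, and suppose $N^+=\sup\{n_k,m_k : k\ge 1\}<\infty$. Then the lower dimension and the Assouad dimension of $E$ are given by $$\dim_{\rm L}E=\lim_{m\to\infty}\inf_{k}\left\{\frac{\log N^-_{k,k+m}(E)}{\log (m_{k+1}\cdots m_{k+m})}\right\},\qquad \dim_{\rm A}E=\lim_{m\to\infty}\sup_{k}\left\{\frac{\log N^+_{k,k+m}(E)}{\log (m_{k+1}\cdots m_{k+m})}\right\},$$ where the infimum and supremum are over integers $k\ge1$.
   Context: Self-affine Moran set: for each integer $k\ge1$ let $n_k\ge2$, $m_k\ge2$ be integers and $\mathcal{D}_k\subset\{0,\dots,n_k-1\}\times\{0,\dots,m_k-1\}$ with $r_k=\operatorname{card}(\mathcal{D}_k)\ge2$. Put $T_k=\operatorname{diag}(n_k^{-1},m_k^{-1})$ and, for $w\in\mathcal{D}_k$, $\Phi_w(x)=T_k(x+w)$ on $\mathbb{R}^2$ (the level $k$ being understood). Let $\Sigma^k=\prod_{j=1}^k\mathcal{D}_j$. For $\mathbf{w}=w_1\cdots w_k\in\Sigma^k$ put $J_{\mathbf{w}}=\Phi_{w_1}\circ\cdots\circ\Phi_{w_k}([0,1]^2)$. The self-affine Moran set is $E=\bigcap_{k\ge1}\bigcup_{\mathbf{w}\in\Sigma^k}J_{\mathbf{w}}$. Counting quantities: $r_k(j)=\operatorname{card}\{i:(i,j)\in\mathcal{D}_k\}$, $r_k^+=\max_{0\le j\le m_k-1}r_k(j)$,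 $r_k^-=\min\{r_k(j):r_k(j)\ne0\}$; $\widehat{r}_k(i)=\operatorname{card}\{j:(i,j)\in\mathcal{D}_k\}$, $\widehat{r}_k^+=\max_{0\le i\le n_k-1}\widehat{r}_k(i)$, $\widehat{r}_k^-=\min\{\widehat{r}_k(i):\widehat{r}_k(i)\neq0\}$; $s_k=\operatorname{card}\{j:(i,j)\in\mathcal{D}_k\text{ for some }i\}$, $\widehat{s}_k=\operatorname{card}\{i:(i,j)\in\mathcal{D}_k\text{ for some }j\}$. For each $k\ge1$ let $l(k)$ be the unique integer $l$ with $\frac1{n_1\cdots n_l}\le\frac1{m_1\cdots m_k}<\frac1{n_1\cdots n_{l-1}}$. For $k'>k\ge1$, with $l=l(k)$, $l'=l(k')$ (so $l\le l'$), set $$N^{\pm}_{k,k'}(E)=\begin{cases} r_{l+1}^{\pm}\cdots r_{l'}^{\pm}\,s_{k+1}\cdots s_{k'}, & l\le l'\le k<k',\\ r_{l+1}^{\pm}\cdots r_k^{\pm}\,r_{k+1}\cdots r_{l'}\,s_{l'+1}\cdots s_{k'}, & l\le k<l'\le k',\\ r_{l+1}^{\pm}\cdots r_k^{\pm}\,r_{k+1}\cdots r_{k'}\,\widehat{s}_{k'+1}\cdots\widehat{s}_{l'}, & l\le k<k'\le l',\\ \widehat{r}_{k+1}^{\pm}\cdots\widehat{r}_l^{\pm}\,r_{l+1}\cdots r_{l'}\,s_{l'+1}\cdots s_{k'}, & k\le l\le l'\le k',\\ \widehat{r}_{k+1}^{\pm}\cdots\widehat{r}_l^{\pm}\,r_{l+1}\cdots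 r_{k'}\,\widehat{s}_{k'+1}\cdots\widehat{s}_{l'}, & k\le l<k'\le l',\\ \widehat{r}_{k+1}^{\pm}\cdots\widehat{r}_{k'}^{\pm}\,\widehat{s}_{l+1}\cdots\widehat{s}_{l'}, & k<k'\le l\le l',\end{cases}$$ with the same sign throughout; empty products equal $1$, and overlapping cases agree. The superscript in $N^{+}_{k,k'}(E)$ is unrelated to the constant $N^+$. Dimensions: for a bounded set $A$ let $N_r(A)$ be the least number of sets of diameter at most $r$ needed to cover $A$. $\dim_{\rm L}E$ is the supremum of $\alpha\ge0$ for which there are $b,c>0$ such that $\inf_{x\in E}N_r(B(x,R)\cap E)\ge c(R/r)^\alpha$ for all $0<r<R<b$. $\dim_{\rm A}E$ is the infimum of $\alpha\ge0$ for which there are $b,c>0$ such that $\sup_{x\in E}N_r(B(x,R)\cap E)\le c(R/r)^\alpha$ for all $0<r<R<b$. *)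

theory Defs
  imports "HOL-Analysis.Analysis"
begin

section \<open>Lower dimension and Assouad dimension\<close>

text \<open>
  The requirement \<^term>\<open>bounded U\<close> is needed because the real-valued \<^const>\<open>diameter\<close> is
  meaningless on unbounded sets.  Bounded subsets of a Euclidean space have finite covers, so
  \<^const>\<open>Least\<close> is well defined there.
\<close>

definition covering_number :: "real \<Rightarrow> 'a::euclidean_space set \<Rightarrow> nat" where
  "covering_number r A =
     (LEAST N. \<exists>\<U>. finite \<U> \<and> card \<U> = N \<and> A \<subseteq> \<Union>\<U> \<and> (\<forall>U\<in>\<U>. bounded U \<and> diameter U \<le> r))"

text \<open>
  Both dimensions are meant for nonempty bounded sets.  For such sets every infimum and supremum
  below (over the points of the set and over the exponents) is taken over a nonempty set of reals
  that is bounded in the relevant direction.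
\<close>

definition lower_dimension :: "'a::euclidean_space set \<Rightarrow> real" where
  "lower_dimension E = Sup {\<alpha>. \<alpha> \<ge> 0 \<and> (\<exists>b>0. \<exists>c>0. \<forall>r R. 0 < r \<and> r < R \<and> R < b \<longrightarrow>
     (INF x\<in>E. real (covering_number r (ball x R \<inter> E))) \<ge> c * (R / r) powr \<alpha>)}"

definition assouad_dimension :: "'a::euclidean_space set \<Rightarrow> real" where
  "assouad_dimension E = Inf {\<alpha>. \<alpha> \<ge> 0 \<and> (\<exists>b>0. \<exists>c>0. \<forall>r R. 0 < r \<and> r < R \<and> R < b \<longrightarrow>
     (SUP x\<in>E. real (covering_number r (ball x R \<inter> E))) \<le> c * (R / r) powr \<alpha>)}"


section \<open>Self-affine Moran sets\<close>

text \<open>Levels start at 1; the values of the sequences at index 0 are never used.\<close>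

definition moran_construction ::
    "(nat \<Rightarrow> nat) \<Rightarrow> (nat \<Rightarrow> nat) \<Rightarrow> (nat \<Rightarrow> (nat \<times> nat) set) \<Rightarrow> bool" where
  "moran_construction n m D \<longleftrightarrow>
     (\<forall>k\<ge>1. n k \<ge> 2 \<and> m k \<ge> 2 \<and> D k \<subseteq> {0..n k - 1} \<times> {0..m k - 1} \<and> card (D k) \<ge> 2)"

definition moran_map ::
    "(nat \<Rightarrow> nat) \<Rightarrow> (nat \<Rightarrow> nat) \<Rightarrow> nat \<Rightarrow> nat \<times> nat \<Rightarrow> real \<times> real \<Rightarrow> real \<times> real" where
  "moran_map n m k w x =
     ((fst x + real (fst w)) / real (n k), (snd x + real (snd w)) / real (m k))"

text \<open>
  \<^term>\<open>moran_comp n m w k\<close> is the composition of the maps for the digits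
  \<^term>\<open>w 1\<close>, ..., \<^term>\<open>w k\<close>, the one for \<^term>\<open>w 1\<close> being outermost.
\<close>

primrec moran_comp ::
    "(nat \<Rightarrow> nat) \<Rightarrow> (nat \<Rightarrow> nat) \<Rightarrow> (nat \<Rightarrow> nat \<times> nat) \<Rightarrow> nat \<Rightarrow> real \<times> real \<Rightarrow> real \<times> real" where
  "moran_comp n m w 0 = id"
| "moran_comp n m w (Suc k) = moran_comp n m w k \<circ> moran_map n m (Suc k) (w (Suc k))"

definition moran_set ::
    "(nat \<Rightarrow> nat) \<Rightarrow> (nat \<Rightarrow> nat) \<Rightarrow> (nat \<Rightarrow> (nat \<times> nat) set) \<Rightarrow> (real \<times> real) set" where
  "moran_set n m D =
     (\<Inter>k\<in>{1..}. \<Union>w\<in>(\<Pi>\<^sub>E j\<in>{1..k}. D j). moran_comp n m w k ` ({0..1} \<times> {0..1}))"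


section \<open>Counting quantities of one digit set\<close>

text \<open>
  For a digit set \<open>A\<close> of the level \<open>k\<close>, with \<open>a\<close> standing for \<open>n\<^sub>k\<close> and \<open>b\<close> for \<open>m\<^sub>k\<close>:
  \<open>row_card\<close>, \<open>row_max\<close>, \<open>row_min\<close>, \<open>row_num\<close> are
  \<open>r\<^sub>k(j)\<close>, \<open>r\<^sub>k\<^sup>+\<close>, \<open>r\<^sub>k\<^sup>-\<close>, \<open>s\<^sub>k\<close>, and the \<open>col\<close> versions are the quantities with a hat.
\<close>

definition row_card :: "(nat \<times> nat) set \<Rightarrow> nat \<Rightarrow> nat" where
  "row_card A j = card {i. (i, j) \<in> A}"

definition col_card :: "(nat \<times> nat) set \<Rightarrow> nat \<Rightarrow> nat" where
  "col_card A i = card {j. (i, j) \<in> A}"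

definition row_max :: "nat \<Rightarrow> (nat \<times> nat) set \<Rightarrow> nat" where
  "row_max b A = Max (row_card A ` {0..b - 1})"

definition col_max :: "nat \<Rightarrow> (nat \<times> nat) set \<Rightarrow> nat" where
  "col_max a A = Max (col_card A ` {0..a - 1})"

definition row_min :: "(nat \<times> nat) set \<Rightarrow> nat" where
  "row_min A = Min {row_card A j | j. row_card A j \<noteq> 0}"

definition col_min :: "(nat \<times> nat) set \<Rightarrow> nat" where
  "col_min A = Min {col_card A i | i. col_card A i \<noteq> 0}"

definition row_num :: "(nat \<times> nat) set \<Rightarrow> nat" where
  "row_num A = card {j. \<exists>i. (i, j) \<in> A}"

definition col_num :: "(nat \<times> nat) set \<Rightarrow> nat" where
  "col_num A = card {i. \<exists>j. (i, j) \<in> A}"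


section \<open>The numbers \<open>N\<^sup>\<plusminus>\<close>\<close>

text \<open>\<open>moran_l n m k\<close> is \<open>l(k)\<close>.  Necessarily \<open>l(k) \<ge> 1\<close>, as \<open>m\<^sub>1 \<cdots> m\<^sub>k > 1\<close> for \<open>k \<ge> 1\<close>.\<close>

definition moran_l :: "(nat \<Rightarrow> nat) \<Rightarrow> (nat \<Rightarrow> nat) \<Rightarrow> nat \<Rightarrow> nat" where
  "moran_l n m k = (THE l. l \<ge> 1 \<and>
     1 / (\<Prod>i=1..l. real (n i)) \<le> 1 / (\<Prod>i=1..k. real (m i)) \<and>
     1 / (\<Prod>i=1..k. real (m i)) < 1 / (\<Prod>i=1..l-1. real (n i)))"

text \<open>
  The case distinction common to both signs: \<open>\<rho>\<close> and \<open>\<rho>h\<close> stand for \<open>r\<^sup>\<plusminus>\<close> and its version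
  with a hat.  For \<open>k < k'\<close> and \<open>l \<le> l'\<close> the six cases are exhaustive (the last branch is
  \<open>k < k' \<le> l \<le> l'\<close>) and agree where they overlap, so their order is immaterial.
\<close>

definition moran_N_aux ::
    "(nat \<Rightarrow> nat) \<Rightarrow> (nat \<Rightarrow> nat) \<Rightarrow> (nat \<Rightarrow> (nat \<times> nat) set) \<Rightarrow> nat \<Rightarrow> nat \<Rightarrow> nat \<Rightarrow> nat \<Rightarrow> nat" where
  "moran_N_aux \<rho> \<rho>h D k k' l l' =
    (let r = (\<lambda>i. card (D i)); s = (\<lambda>i. row_num (D i)); sh = (\<lambda>i. col_num (D i)) in
     if l \<le> l' \<and> l' \<le> k \<and> k < k' then
       (\<Prod>i=l+1..l'. \<rho> i) * (\<Prod>i=k+1..k'. s i)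
     else if l \<le> k \<and> k < l' \<and> l' \<le> k' then
       (\<Prod>i=l+1..k. \<rho> i) * (\<Prod>i=k+1..l'. r i) * (\<Prod>i=l'+1..k'. s i)
     else if l \<le> k \<and> k < k' \<and> k' \<le> l' then
       (\<Prod>i=l+1..k. \<rho> i) * (\<Prod>i=k+1..k'. r i) * (\<Prod>i=k'+1..l'. sh i)
     else if k \<le> l \<and> l \<le> l' \<and> l' \<le> k' then
       (\<Prod>i=k+1..l. \<rho>h i) * (\<Prod>i=l+1..l'. r i) * (\<Prod>i=l'+1..k'. s i)
     else if k \<le> l \<and> l < k' \<and> k' \<le> l' then
       (\<Prod>i=k+1..l. \<rho>h i) * (\<Prod>i=l+1..k'. r i) * (\<Prod>i=k'+1..l'. sh i)
     else
       (\<Prod>i=k+1..k'. \<rho>h i) * (\<Prod>i=l+1..l'. sh i))"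

definition moran_N_plus ::
    "(nat \<Rightarrow> nat) \<Rightarrow> (nat \<Rightarrow> nat) \<Rightarrow> (nat \<Rightarrow> (nat \<times> nat) set) \<Rightarrow> nat \<Rightarrow> nat \<Rightarrow> nat" where
  "moran_N_plus n m D k k' =
     moran_N_aux (\<lambda>i. row_max (m i) (D i)) (\<lambda>i. col_max (n i) (D i)) D
       k k' (moran_l n m k) (moran_l n m k')"

definition moran_N_minus ::
    "(nat \<Rightarrow> nat) \<Rightarrow> (nat \<Rightarrow> nat) \<Rightarrow> (nat \<Rightarrow> (nat \<times> nat) set) \<Rightarrow> nat \<Rightarrow> nat \<Rightarrow> nat" where
  "moran_N_minus n m D k k' =
     moran_N_aux (\<lambda>i. row_min (D i)) (\<lambda>i. col_min (D i)) D
       k k' (moran_l n m k) (moran_l n m k')"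

end

theory Submission
  imports Defs
begin

text \<open>
  The approximate squares of level \<open>k\<close> are the cells obtained by fixing the first \<open>l(k)\<close> horizontal and
  the first \<open>k\<close> vertical digits; their sides are comparable to \<open>1 / (m\<^sub>1 \<cdots> m\<^sub>k)\<close>.  The number of approximate
  squares of level \<open>k'\<close> in one of level \<open>k\<close> is a product over the digit positions, whose extreme values
  over all squares of level \<open>k\<close> are \<open>N\<^sup>\<plusminus>\<close>.  Factor by factor, \<open>N\<^sup>-\<close> is supermultiplicative and \<open>N\<^sup>+\<close> is
  submultiplicative.  A set of diameter \<open>r\<close> meets boundedly many cells with sides at least \<open>r\<close>, so these
  numbers are covering numbers up to constants.

  The delicate point is to find a ball centred in \<open>E\<close> that is covered by only \<open>N\<^sup>-\<close> squares, since the
  neighbours of a poor square may be rich.  Taking the least admissible digit at one level and the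
  greatest one at the next keeps the centre away from all points of \<open>E\<close> in neighbouring cells, at the
  cost of a bounded factor in the radius.  Exact super- and submultiplicativity make each single
  extremal ratio an admissible exponent, which gives the existence of the limits.
\<close>

section \<open>Covering numbers\<close>

text \<open>Of the four comparisons between cell counts and covering numbers, three are insensitive
  to neighbouring squares. A ball larger than a square contains it, so both lower bounds on covering
  numbers are immediate; a ball of comparable size meets boundedly many squares, and N^+ bounds all
  of them at once. Only the upper bound by N^- needs an isolated square. Isolation does not conflict
  with minimality: at the positions where one coordinate is already known and the other is not, only
  the known coordinate influences the count, and the digits used for isolation come later in that
  coordinate or belong to the other one. The six cases of N^+ and N^- are orderings of four
  thresholds. Recording at each position which coordinates are known before and after turns them
  into one product, and multiplicativity reduces to r^- s \<le> r \<le> r^+ s and the same with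
  hats. The limits need no subadditive limit theorem: an admissible exponent bounds every ratio up
  to an error O(1/m), and every extremal ratio is itself admissible, which squeezes the extremal
  ratios towards the dimension.\<close>

lemma covering_number_le:
  assumes "finite \<U>" "A \<subseteq> \<Union>\<U>" "\<And>U. U \<in> \<U> \<Longrightarrow> bounded U \<and> diameter U \<le> r"
  shows "covering_number r A \<le> card \<U>"
  unfolding covering_number_def by (rule Least_le) (use assms in blast)

lemma covering_number_cover:
  assumes "bounded A" "r > 0"
  obtains \<U> where "finite \<U>" "card \<U> = covering_number r A" "A \<subseteq> \<Union>\<U>"
    "\<And>U. U \<in> \<U> \<Longrightarrow> bounded U \<and> diameter U \<le> r"
proof -
  have "compact (closure A)" using assms by simp
  then obtain X where X: "finite X" "closure A \<subseteq> (\<Union>x\<in>X. ball x (r/2))"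
  proof (rule compactE_image[of "closure A" "closure A" "\<lambda>x. ball x (r/2)"])
    show "closure A \<subseteq> (\<Union>x\<in>closure A. ball x (r/2))" using assms(2) by auto
  qed auto
  have "\<exists>\<U>. finite \<U> \<and> card \<U> = card ((\<lambda>x. ball x (r/2)) ` X) \<and> A \<subseteq> \<Union>\<U>
      \<and> (\<forall>U\<in>\<U>. bounded U \<and> diameter U \<le> r)"
    by (rule exI[of _ "(\<lambda>x. ball x (r/2)) ` X"])
      (use X closure_subset[of A] assms in \<open>auto simp: diameter_ball\<close>)
  then have "\<exists>N \<U>. finite \<U> \<and> card \<U> = N \<and> A \<subseteq> \<Union>\<U>
      \<and> (\<forall>U\<in>\<U>. bounded U \<and> diameter U \<le> r)" by blast
  from LeastI_ex[OF this] show ?thesis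
    using that unfolding covering_number_def by blast
qed

lemma covering_number_mono:
  assumes "A \<subseteq> B" "bounded B" "r > 0"
  shows "covering_number r A \<le> covering_number r B"
proof -
  obtain \<U> where "finite \<U>" "card \<U> = covering_number r B" "B \<subseteq> \<Union>\<U>"
    "\<And>U. U \<in> \<U> \<Longrightarrow> bounded U \<and> diameter U \<le> r"
    using covering_number_cover[OF assms(2,3)] by metis
  then show ?thesis using covering_number_le[of \<U> A r] assms(1) by (metis order_trans)
qed

lemma covering_number_ge_1:
  assumes "bounded A" "r > 0" "A \<noteq> {}"
  shows "covering_number r A \<ge> 1"
proof -
  obtain \<U> where "finite \<U>" "card \<U> = covering_number r A" "A \<subseteq> \<Union>\<U>"
    using covering_number_cover[OF assms(1,2)] by metis
  then show ?thesis using assms(3) by (cases "\<U> = {}") (auto simp: Suc_le_eq card_gt_0_iff)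
qed


section \<open>Limits of extremal ratios\<close>

text \<open>Division by \<open>h k p \<ge> p * d\<close> turns the additive error \<open>c\<close>
  of an exponent in \<open>S\<close> into O(1/p), so each element of \<open>S\<close> is at most the
  lower limit of the infima. By \<open>mem\<close> the infima never exceed \<open>Sup S\<close>. The
  bound on \<open>g\<close> keeps the ratios bounded, so that \<open>INF\<close> and
  \<open>Sup\<close> of reals are meaningful.\<close>

lemma INF_ratio_tendsto_Sup:
  fixes g h :: "nat \<Rightarrow> nat \<Rightarrow> real"
  assumes d: "d > 0" and h: "\<And>k p. k \<ge> 1 \<Longrightarrow> real p * d \<le> h k p"
    and g: "\<And>k p. k \<ge> 1 \<Longrightarrow> \<bar>g k p\<bar> \<le> C + C * h k p"
    and S: "\<And>\<alpha>. \<alpha> \<in> S \<Longrightarrow> \<exists>c. \<forall>k\<ge>1. \<forall>p. \<alpha> * h k p - c \<le> g k p"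
    and mem: "\<And>p. p \<ge> 1 \<Longrightarrow> (INF k\<in>{1..}. g k p / h k p) \<in> S"
  shows "(\<lambda>p. INF k\<in>{1..}. g k p / h k p) \<longlonglongrightarrow> Sup S"
proof -
  define a where "a = (\<lambda>p. INF k\<in>{1..}. g k p / h k p)"
  \<comment> \<open>The instance \<open>p = 0\<close> forces \<open>C\<close> to be
    nonnegative.\<close>
  have "\<bar>g 1 0\<bar> \<le> C + C * h 1 0" and "h 1 0 \<ge> 0" using g[of 1 0] h[of 1 0] by auto
  then have "0 \<le> C * (1 + h 1 0)" "1 + h 1 0 > 0" by (auto simp: algebra_simps)
  then have C: "C \<ge> 0" by (simp add: zero_le_mult_iff)
  have hpos: "h k p \<ge> d" if "k \<ge> 1" "p \<ge> 1" for k p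
    using h[OF that(1), of p] d mult_right_mono[of 1 "real p" d] that(2) by linarith
  have q: "\<bar>g k p / h k p\<bar> \<le> C / d + C" if "k \<ge> 1" "p \<ge> 1" for k p
  proof -
    have "\<bar>g k p / h k p\<bar> \<le> (C + C * h k p) / h k p"
      using g[OF that(1), of p] hpos[OF that] d by (auto simp: divide_right_mono)
    also have "\<dots> = C / h k p + C" using hpos[OF that] d by (simp add: add_divide_distrib)
    also have "\<dots> \<le> C / d + C" using hpos[OF that] d C by (simp add: frac_le)
    finally show ?thesis .
  qed
  have bdd: "bdd_below ((\<lambda>k. g k p / h k p) ` {1..})" if "p \<ge> 1" for p
  proof (rule bdd_belowI2[of _ "- (C / d + C)"])
    fix k :: nat assume "k \<in> {1..}"
    then have "k \<ge> 1" by simp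
    from q[OF this that] show "- (C / d + C) \<le> g k p / h k p" by linarith
  qed
  have a_le: "a p \<le> C / d + C" if "p \<ge> 1" for p
    using cINF_lower[OF bdd[OF that], of 1] q[OF le_refl that] abs_ge_self[of "g 1 p / h 1 p"]
    unfolding a_def by (simp del: abs_divide)
  have low: "\<exists>c. \<forall>p\<ge>1. \<alpha> - c / real p \<le> a p" if "\<alpha> \<in> S" for \<alpha>
  proof -
    obtain c where c: "\<And>k p. k \<ge> 1 \<Longrightarrow> \<alpha> * h k p - c \<le> g k p" using S[OF \<open>\<alpha> \<in> S\<close>] by blast
    have "\<alpha> - (\<bar>c\<bar> / d) / real p \<le> a p" if p: "p \<ge> 1" for p
      unfolding a_def
    proof (rule cINF_greatest)
      fix k :: nat assume "k \<in> {1..}"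
      then have k: "k \<ge> 1" by simp
      have hp: "h k p > 0" using hpos[OF k p] d by linarith
      have "\<alpha> - g k p / h k p = (\<alpha> * h k p - g k p) / h k p" using hp by (simp add: field_simps)
      also have "\<dots> \<le> \<bar>c\<bar> / h k p" using c[OF k, of p] hp by (intro divide_right_mono) auto
      also have "\<dots> \<le> \<bar>c\<bar> / (real p * d)" using h[OF k, of p] p d hp by (intro divide_left_mono mult_pos_pos) auto
      finally show "\<alpha> - (\<bar>c\<bar> / d) / real p \<le> g k p / h k p" by (simp add: mult.commute)
    qed auto
    then show ?thesis by blast
  qed
  have lim: "(\<lambda>p. \<alpha> - c / real p) \<longlonglongrightarrow> \<alpha>" for \<alpha> c :: real
    using tendsto_diff[OF tendsto_const lim_const_over_n[of c], of \<alpha>] by simp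
  \<comment> \<open>The uniform bound on the infima passes to the limit and bounds
    \<open>S\<close>.\<close>
  have "\<alpha> \<le> C / d + C" if \<alpha>: "\<alpha> \<in> S" for \<alpha>
  proof -
    obtain c where "\<forall>p\<ge>1. \<alpha> - c / real p \<le> a p" using low[OF \<alpha>] by blast
    then show ?thesis
      by (intro LIMSEQ_le_const2[OF lim[of \<alpha> c]] exI[of _ 1]) (use a_le in force)
  qed
  then have bS: "bdd_above S" by (rule bdd_aboveI)
  have neS: "S \<noteq> {}" using mem[of 1] by auto
  have "a \<longlonglongrightarrow> Sup S"
  proof (rule order_tendstoI)
    fix x assume "x < Sup S"
    then obtain \<alpha> where \<alpha>: "\<alpha> \<in> S" "x < \<alpha>" using less_cSup_iff[OF neS bS] by blast
    obtain c where c: "\<forall>p\<ge>1. \<alpha> - c / real p \<le> a p" using low[OF \<alpha>(1)] by blast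
    have "\<forall>\<^sub>F p in sequentially. x < \<alpha> - c / real p"
      using order_tendstoD(1)[OF lim \<alpha>(2)] .
    then show "\<forall>\<^sub>F p in sequentially. x < a p"
      using eventually_ge_at_top[of 1] by eventually_elim (use c in force)
  next
    fix x assume "Sup S < x"
    have "a p < x" if "p \<ge> 1" for p
      using cSup_upper[OF mem[OF that] bS] \<open>Sup S < x\<close> by (simp add: a_def)
    then show "\<forall>\<^sub>F p in sequentially. a p < x" by (rule eventually_sequentiallyI)
  qed
  then show ?thesis by (simp add: a_def)
qed

lemma SUP_ratio_tendsto_Inf:
  fixes g h :: "nat \<Rightarrow> nat \<Rightarrow> real"
  assumes d: "d > 0" and h: "\<And>k p. k \<ge> 1 \<Longrightarrow> real p * d \<le> h k p"
    and g: "\<And>k p. k \<ge> 1 \<Longrightarrow> \<bar>g k p\<bar> \<le> C + C * h k p"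
    and S: "\<And>\<alpha>. \<alpha> \<in> S \<Longrightarrow> \<exists>c. \<forall>k\<ge>1. \<forall>p. g k p \<le> \<alpha> * h k p + c"
    and mem: "\<And>p. p \<ge> 1 \<Longrightarrow> (SUP k\<in>{1..}. g k p / h k p) \<in> S"
  shows "(\<lambda>p. SUP k\<in>{1..}. g k p / h k p) \<longlonglongrightarrow> Inf S"
proof -
  have eq: "(INF k\<in>{1..}. - g k p / h k p) = - (SUP k\<in>{1..}. g k p / h k p)" for p
    by (simp add: Inf_real_def image_image)
  have "(\<lambda>p. INF k\<in>{1..}. - g k p / h k p) \<longlonglongrightarrow> Sup (uminus ` S)"
  proof (rule INF_ratio_tendsto_Sup[OF d h, where C = C])
    fix \<alpha> assume "\<alpha> \<in> uminus ` S"
    then obtain c where "\<forall>k\<ge>1. \<forall>p. g k p \<le> (- \<alpha>) * h k p + c" using S[of "- \<alpha>"] by auto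
    then have "\<alpha> * h k p - c \<le> - g k p" if "k \<ge> 1" for k p using that by (smt (verit) mult_minus_left)
    then show "\<exists>c. \<forall>k\<ge>1. \<forall>p. \<alpha> * h k p - c \<le> - g k p" by blast
  qed (use g mem eq in auto)
  from tendsto_minus[OF this] show ?thesis unfolding eq by (simp add: Inf_real_def)
qed

text \<open>Blocks of length \<open>p\<close> are split off from the left, each contributing at
  least \<open>a * h\<close>; the constant \<open>c\<close> is paid once, for the final block
  shorter than \<open>p\<close>. The sign of \<open>a\<close> is free, so that the subadditive case
  follows by negation.\<close>

lemma superadditive_ratio_bound:
  fixes g h :: "nat \<Rightarrow> nat \<Rightarrow> real"
  assumes "p \<ge> 1"
    and sup: "\<And>k j. k \<ge> 1 \<Longrightarrow> g k p + g (k + p) j \<le> g k (p + j)"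
    and add: "\<And>k j. k \<ge> 1 \<Longrightarrow> h k (p + j) = h k p + h (k + p) j"
    and a: "\<And>k. k \<ge> 1 \<Longrightarrow> a * h k p \<le> g k p"
    and c: "\<And>k j. k \<ge> 1 \<Longrightarrow> j < p \<Longrightarrow> a * h k j - c \<le> g k j"
  shows "k \<ge> 1 \<Longrightarrow> a * h k j - c \<le> g k j"
proof (induction j arbitrary: k rule: less_induct)
  case (less j)
  show ?case
  proof (cases "j < p")
    case False
    then have "a * h (k + p) (j - p) - c \<le> g (k + p) (j - p)"
      using less \<open>p \<ge> 1\<close> by simp
    then show ?thesis
      using sup[of k "j - p"] add[of k "j - p"] a[of k] less.prems False by (simp add: distrib_left)
  qed (use c less.prems in auto)
qed

section \<open>Digit expansions in one coordinate\<close>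

definition lev :: "(nat \<Rightarrow> nat) \<Rightarrow> nat \<Rightarrow> real" where
  "lev b p = (\<Prod>i=1..p. real (b i))"

text \<open>Mixed-radix numeral with most significant digit \<open>u 1\<close>;
  \<open>code b u p / lev b p\<close> is the left endpoint of the basic interval. With integer
  codes, adjacency of intervals becomes a difference of at most 1.\<close>

primrec code :: "(nat \<Rightarrow> nat) \<Rightarrow> (nat \<Rightarrow> nat) \<Rightarrow> nat \<Rightarrow> nat" where
  "code b u 0 = 0"
| "code b u (Suc p) = code b u p * b (Suc p) + u (Suc p)"

definition digit_int :: "(nat \<Rightarrow> nat) \<Rightarrow> nat \<Rightarrow> nat \<Rightarrow> real set" where
  "digit_int b p c = {real c / lev b p .. (real c + 1) / lev b p}"

lemma lev_0 [simp]: "lev b 0 = 1" by (simp add: lev_def)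

lemma lev_Suc: "lev b (Suc p) = lev b p * real (b (Suc p))" by (simp add: lev_def)

lemma lev_split: "p \<le> q \<Longrightarrow> lev b q = lev b p * (\<Prod>i=p+1..q. real (b i))"
  by (induction rule: dec_induct) (simp_all add: lev_Suc)

lemma lev_ge_1: "(\<And>i. i \<ge> 1 \<Longrightarrow> b i \<ge> 2) \<Longrightarrow> lev b p \<ge> 1"
proof (induction p)
  case (Suc p)
  have "real (b (Suc p)) \<ge> 1" using Suc.prems[of "Suc p"] by simp
  from mult_mono[of 1 "lev b p", OF _ this] Suc show ?case by (simp add: lev_Suc)
qed simp

lemma lev_growth:
  assumes "\<And>i. i \<ge> 1 \<Longrightarrow> b i \<ge> 2" "p \<le> q"
  shows "2 ^ (q - p) * lev b p \<le> lev b q"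
  using assms(2)
proof (induction rule: dec_induct)
  case (step q)
  have "2 * (2 ^ (q - p) * lev b p) \<le> real (b (Suc q)) * lev b q"
    using step assms(1)[of "Suc q"] lev_ge_1[of b p] assms(1) by (intro mult_mono) auto
  with step show ?case by (simp add: lev_Suc Suc_diff_le mult.commute)
qed simp

lemma lev_mono:
  assumes "\<And>i. i \<ge> 1 \<Longrightarrow> b i \<ge> 2" "p \<le> q"
  shows "lev b p \<le> lev b q"
proof -
  have "1 * lev b p \<le> 2 ^ (q - p) * lev b p"
    using lev_ge_1[of b p] assms(1) by (intro mult_right_mono) auto
  then show ?thesis using lev_growth[of b p q] assms by auto
qed

lemma lev_le_power:
  assumes "\<And>i. i \<ge> 1 \<Longrightarrow> b i \<le> L" "p \<le> q"
  shows "lev b q \<le> lev b p * real L ^ (q - p)"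
  using assms(2)
proof (induction rule: dec_induct)
  case (step q)
  have "lev b q * real (b (Suc q)) \<le> (lev b p * real L ^ (q - p)) * real L"
    using step assms(1)[of "Suc q"] by (intro mult_mono) (auto simp: lev_def intro!: prod_nonneg mult_nonneg_nonneg)
  with step show ?case by (simp add: lev_Suc Suc_diff_le mult_ac)
qed simp

lemma code_cong: "(\<And>i. 1 \<le> i \<Longrightarrow> i \<le> p \<Longrightarrow> u i = v i) \<Longrightarrow> code b u p = code b v p"
  by (induction p) auto

text \<open>Quotient and remainder by the last base recover the shorter code and the last
  digit.\<close>

lemma code_inj:
  assumes "\<And>i. 1 \<le> i \<Longrightarrow> i \<le> p \<Longrightarrow> u i < b i" "\<And>i. 1 \<le> i \<Longrightarrow> i \<le> p \<Longrightarrow> v i < b i"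
    "code b u p = code b v p" "1 \<le> i" "i \<le> p"
  shows "u i = v i"
  using assms
proof (induction p)
  case (Suc p)
  have lt: "u (Suc p) < b (Suc p)" "v (Suc p) < b (Suc p)" using Suc.prems(1,2) by auto
  have eq: "code b u p * b (Suc p) + u (Suc p) = code b v p * b (Suc p) + v (Suc p)"
    using Suc.prems by simp
  have "code b u p = code b v p"
    using arg_cong[OF eq, of "\<lambda>x. x div b (Suc p)"] lt by simp
  moreover have "u (Suc p) = v (Suc p)"
    using arg_cong[OF eq, of "\<lambda>x. x mod b (Suc p)"] lt by simp
  ultimately show ?case using Suc by (cases "i = Suc p") auto
qed simp

lemma mem_digit_int: "lev b p > 0 \<Longrightarrow>
    t \<in> digit_int b p c \<longleftrightarrow> real c \<le> t * lev b p \<and> t * lev b p \<le> real c + 1"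
  by (auto simp: digit_int_def field_simps)

lemma digit_int_Suc_subset:
  assumes "lev b p > 0" "u (Suc p) < b (Suc p)"
  shows "digit_int b (Suc p) (code b u (Suc p)) \<subseteq> digit_int b p (code b u p)"
proof
  fix t assume t: "t \<in> digit_int b (Suc p) (code b u (Suc p))"
  let ?b = "real (b (Suc p))" and ?c = "real (code b u p)"
  have b: "?b > 0" using assms(2) by simp
  have pos: "lev b (Suc p) > 0" using assms b by (simp add: lev_Suc)
  have "?c * ?b + real (u (Suc p)) \<le> t * lev b p * ?b"
    "t * lev b p * ?b \<le> ?c * ?b + real (u (Suc p)) + 1"
    using t unfolding mem_digit_int[OF pos] lev_Suc by (simp_all add: mult_ac)
  moreover have "real (u (Suc p)) + 1 \<le> ?b" "(?c + 1) * ?b = ?c * ?b + ?b" "0 \<le> real (u (Suc p))"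
    using assms(2) by (simp_all add: distrib_right)
  ultimately have "?c * ?b \<le> t * lev b p * ?b" "t * lev b p * ?b \<le> (?c + 1) * ?b"
    by linarith+
  then show "t \<in> digit_int b p (code b u p)"
    using b assms(1) by (simp add: mem_digit_int)
qed

lemma digit_int_antimono:
  assumes "\<And>i. i \<ge> 1 \<Longrightarrow> b i \<ge> 2" "\<And>i. i \<ge> 1 \<Longrightarrow> u i < b i" "p \<le> q"
  shows "digit_int b q (code b u q) \<subseteq> digit_int b p (code b u p)"
  using assms(3)
proof (induction rule: dec_induct)
  case (step q)
  have "lev b q > 0" using lev_ge_1[of b q] assms(1) by force
  from digit_int_Suc_subset[OF this, of u] step assms(2)[of "Suc q"] show ?case by auto
qed simp

text \<open>Nested intervals: every left endpoint is below every right endpoint, so the supremum of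
  the left endpoints lies in all of them.\<close>

lemma ex_point_of_digits:
  assumes "\<And>i. i \<ge> 1 \<Longrightarrow> b i \<ge> 2" "\<And>i. i \<ge> 1 \<Longrightarrow> u i < b i"
  shows "\<exists>t. \<forall>p. t \<in> digit_int b p (code b u p)"
proof -
  let ?f = "\<lambda>p. real (code b u p) / lev b p" and ?g = "\<lambda>p. (real (code b u p) + 1) / lev b p"
  have pos: "lev b p > 0" for p using lev_ge_1[of b p] assms(1) by force
  have fg: "?f p \<le> ?g p" for p using pos[of p] by (simp add: divide_right_mono)
  have "?f p \<le> ?f q \<and> ?g q \<le> ?g p" if "p \<le> q" for p q
    using digit_int_antimono[of b u, OF assms that] fg[of q] by (simp add: digit_int_def)
  then have le: "?f q \<le> ?g p" for p q
    using fg by (meson linear order_trans)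
  have "(SUP q. ?f q) \<in> digit_int b p (code b u p)" for p
    unfolding digit_int_def atLeastAtMost_iff
  proof (intro conjI)
    show "?f p \<le> (SUP q. ?f q)" by (rule cSUP_upper[OF UNIV_I bdd_aboveI2[OF le[of _ p]]])
    show "(SUP q. ?f q) \<le> ?g p" by (rule cSUP_least) (use le in auto)
  qed
  then show ?thesis by blast
qed

lemma digit_int_dist:
  assumes "lev b p > 0" "s \<in> digit_int b p c" "t \<in> digit_int b p c"
  shows "\<bar>s - t\<bar> \<le> 1 / lev b p"
proof -
  have "(real c + 1) / lev b p = real c / lev b p + 1 / lev b p" by (simp add: add_divide_distrib)
  then show ?thesis using assms by (auto simp: digit_int_def)
qed

text \<open>The strict inequality matters: it puts the codes at distance less than 2, hence at most
  1.\<close>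

lemma close_digit_ints:
  assumes "lev b p > 0" "s \<in> digit_int b p c" "t \<in> digit_int b p c'" "\<bar>s - t\<bar> < 1 / lev b p"
  shows "\<bar>int c - int c'\<bar> \<le> 1"
proof -
  have "\<bar>s - t\<bar> * lev b p < 1" using assms(1,4) by (simp add: field_simps)
  then have "\<bar>s * lev b p - t * lev b p\<bar> < 1"
    using assms(1) by (simp add: abs_mult left_diff_distrib[symmetric])
  moreover have "real c \<le> s * lev b p" "s * lev b p \<le> real c + 1"
    "real c' \<le> t * lev b p" "t * lev b p \<le> real c' + 1"
    using assms(1-3) by (simp_all add: mem_digit_int)
  ultimately have "\<bar>real c - real c'\<bar> < 2" by linarith
  then show ?thesis by linarith
qed

lemma digit_ints_near_point:
  assumes "lev b p > 0" "\<rho> * lev b p \<le> 1"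
  shows "\<exists>F. finite F \<and> card F \<le> 4 \<and> {c. \<exists>t\<in>digit_int b p c. \<bar>t - x\<bar> \<le> \<rho>} \<subseteq> F"
proof (intro exI conjI)
  \<comment> \<open>After scaling, a relevant \<open>c\<close> satisfies
    \<open>?y - 2 \<le> c \<le> ?y + 1\<close>, a range of length 3 with at most four integers.
    Negative integers collapse to 0 under \<open>nat\<close>, which is harmless for an upper
    bound.\<close>
  let ?y = "x * lev b p" and ?I = "\<lambda>y. {\<lceil>y\<rceil> - 2 .. \<lfloor>y\<rfloor> + 1}"
  show "finite (nat ` ?I ?y)" by simp
  have "card (nat ` ?I ?y) \<le> card (?I ?y)" by (rule card_image_le) simp
  also have "\<dots> \<le> 4" by simp linarith
  finally show "card (nat ` ?I ?y) \<le> 4" .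
  show "{c. \<exists>t\<in>digit_int b p c. \<bar>t - x\<bar> \<le> \<rho>} \<subseteq> nat ` ?I ?y"
  proof safe
    fix c t assume t: "t \<in> digit_int b p c" "\<bar>t - x\<bar> \<le> \<rho>"
    have "\<bar>t - x\<bar> * lev b p \<le> \<rho> * lev b p" using t assms by (intro mult_right_mono) auto
    moreover have "\<bar>t * lev b p - ?y\<bar> = \<bar>t - x\<bar> * lev b p"
      using assms(1) by (simp add: abs_mult left_diff_distrib[symmetric])
    ultimately have "\<bar>t * lev b p - ?y\<bar> \<le> 1" using assms(2) by linarith
    then have "?y - 2 \<le> real c" "real c \<le> ?y + 1"
      using t(1) assms(1) by (auto simp: mem_digit_int abs_le_iff)
    then have "int c \<in> ?I ?y" unfolding atLeastAtMost_iff by linarith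
    then show "c \<in> nat ` ?I ?y" by (metis image_eqI nat_int)
  qed
qed

text \<open>The digits \<open>v\<close> range over all admissible ones and \<open>w\<close> takes the least, then the greatest of them:
  with \<open>P\<close> and \<open>Q\<close> the two bases, the code distance to words in higher intervals exceeds \<open>P Q - Q\<close> and that
  to words in lower intervals is at least \<open>Q\<close>.\<close>

lemma code_separation:
  assumes "b (p+1) \<ge> 2" "b (p+2) \<ge> 2" "v (p+1) < b (p+1)" "w (p+1) \<le> v (p+1)"
    "v (p+2) \<le> w (p+2)" "w (p+2) < b (p+2)"
    and close: "\<bar>int (code b v (p+2)) - int (code b w (p+2))\<bar> \<le> 1"
  shows "code b v p = code b w p"
proof -
  define P Q a a' where "P = int (b (p+1))" and "Q = int (b (p+2))"
    and "a = int (code b v p)" and "a' = int (code b w p)"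
  define v1 v2 w1 w2 where "v1 = int (v (p+1))" and "v2 = int (v (p+2))"
    and "w1 = int (w (p+1))" and "w2 = int (w (p+2))"
  have hyps: "2 \<le> P" "2 \<le> Q" "v1 \<le> P - 1" "w1 \<le> v1" "v2 \<le> w2" "w2 \<le> Q - 1" "0 \<le> v2" "0 \<le> w1"
    using assms by (auto simp: P_def Q_def v1_def v2_def w1_def w2_def)
  have c: "\<bar>((a - a') * P + (v1 - w1)) * Q + (v2 - w2)\<bar> \<le> 1"
    using close by (simp add: P_def Q_def a_def a'_def v1_def v2_def w1_def w2_def algebra_simps numeral_2_eq_2)
  have "a = a'"
  proof (rule ccontr)
    assume "a \<noteq> a'"
    then consider "a - a' \<ge> 1" | "a - a' \<le> -1" by linarith
    then show False
    proof cases
      case 1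
      then have "1 * P \<le> (a - a') * P" using hyps by (intro mult_right_mono) auto
      then have "2 \<le> (a - a') * P + (v1 - w1)" using hyps by linarith
      then have "2 * Q \<le> ((a - a') * P + (v1 - w1)) * Q" using hyps by (intro mult_right_mono) auto
      then show False using c hyps by linarith
    next
      case 2
      then have "(a - a') * P \<le> (-1) * P" using hyps by (intro mult_right_mono) auto
      then have "(a - a') * P + (v1 - w1) \<le> -1" using hyps by linarith
      then have "((a - a') * P + (v1 - w1)) * Q \<le> (-1) * Q" using hyps by (intro mult_right_mono) auto
      then show False using c hyps by linarith
    qed
  qed
  then show ?thesis by (simp add: a_def a'_def)
qed


section \<open>Counting cells\<close>

text \<open>The number of ways to refine a cell at a single digit position. \<open>\<rho>\<close>
  and \<open>\<rho>h\<close> are left as parameters because the same formula serves the fibres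
  through a given word and the extremal fibres.\<close>

definition level_factor ::
    "nat \<Rightarrow> nat \<Rightarrow> (nat \<times> nat) set \<Rightarrow> bool \<Rightarrow> bool \<Rightarrow> bool \<Rightarrow> bool \<Rightarrow> nat" where
  "level_factor \<rho> \<rho>h A a b a' b' =
    (if a \<and> b then 1
     else if a then (if b' then \<rho>h else 1)
     else if b then (if a' then \<rho> else 1)
     else if a' then (if b' then card A else col_num A)
     else if b' then row_num A else 1)"

text \<open>The booleans say whether the two coordinates of the \<open>i\<close>-th digit are determined by a cell with
  \<open>p\<close> horizontal and \<open>q\<close> vertical digits, and by its subcells with \<open>p'\<close> and \<open>q'\<close> digits.\<close>

definition cell_count ::
    "(nat \<Rightarrow> nat) \<Rightarrow> (nat \<Rightarrow> nat) \<Rightarrow> (nat \<Rightarrow> (nat \<times> nat) set) \<Rightarrow> nat \<Rightarrow> nat \<Rightarrow> nat \<Rightarrow> nat \<Rightarrow> nat" where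
  "cell_count \<rho> \<rho>h D p q p' q' =
    (\<Prod>i=1..max p' q'. level_factor (\<rho> i) (\<rho>h i) (D i) (i \<le> p) (i \<le> q) (i \<le> p') (i \<le> q'))"

lemma level_factor_cong:
  "(b \<and> \<not> a \<Longrightarrow> \<rho> = \<sigma>) \<Longrightarrow> (a \<and> \<not> b \<Longrightarrow> \<rho>h = \<sigma>h) \<Longrightarrow>
    level_factor \<rho> \<rho>h A a b a' b' = level_factor \<sigma> \<sigma>h A a b a' b'"
  by (auto simp: level_factor_def)

lemma level_factor_mono:
  "\<rho> \<le> \<sigma> \<Longrightarrow> \<rho>h \<le> \<sigma>h \<Longrightarrow> level_factor \<rho> \<rho>h A a b a' b' \<le> level_factor \<sigma> \<sigma>h A a b a' b'"
  by (auto simp: level_factor_def)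

lemma cell_count_mono:
  assumes "\<And>i. i \<ge> 1 \<Longrightarrow> \<rho> i \<le> \<sigma> i" "\<And>i. i \<ge> 1 \<Longrightarrow> \<rho>h i \<le> \<sigma>h i"
  shows "cell_count \<rho> \<rho>h D p q p' q' \<le> cell_count \<sigma> \<sigma>h D p q p' q'"
  unfolding cell_count_def by (rule prod_mono) (use assms in \<open>auto intro!: level_factor_mono\<close>)

lemma cell_count_eq_prod:
  assumes "p \<le> p'" "q \<le> q'" "max p' q' \<le> K"
  shows "cell_count \<rho> \<rho>h D p q p' q' =
    (\<Prod>i=1..K. level_factor (\<rho> i) (\<rho>h i) (D i) (i \<le> p) (i \<le> q) (i \<le> p') (i \<le> q'))"
  unfolding cell_count_def
  by (rule prod.mono_neutral_left) (use assms in \<open>auto simp: level_factor_def\<close>)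

text \<open>All positions give equality except those where nothing is known at first, exactly one
  coordinate in the intermediate cell, and both at the end. There the left side is
  \<open>\<rho> i * row_num (D i)\<close> or \<open>\<rho>h i * col_num (D i)\<close>, and the right
  side is \<open>card (D i)\<close>.\<close>

lemma cell_count_supermult:
  assumes "\<And>i. i \<ge> 1 \<Longrightarrow> \<rho> i * row_num (D i) \<le> card (D i)"
    and "\<And>i. i \<ge> 1 \<Longrightarrow> \<rho>h i * col_num (D i) \<le> card (D i)"
    and "p \<le> p'" "q \<le> q'" "p' \<le> p''" "q' \<le> q''"
  shows "cell_count \<rho> \<rho>h D p q p' q' * cell_count \<rho> \<rho>h D p' q' p'' q'' \<le> cell_count \<rho> \<rho>h D p q p'' q''"
proof -
  let ?K = "max p'' q''"
  have K: "max p' q' \<le> ?K" "max p'' q'' \<le> ?K" "p \<le> p''" "q \<le> q''" using assms by auto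
  show ?thesis
    unfolding cell_count_eq_prod[OF assms(3,4) K(1)] cell_count_eq_prod[OF assms(5,6) K(2)]
      cell_count_eq_prod[OF K(3,4,2)] prod.distrib[symmetric]
  proof (rule prod_mono, safe)
    fix i assume "i \<in> {1..?K}"
    then have "\<rho> i * row_num (D i) \<le> card (D i)" "\<rho>h i * col_num (D i) \<le> card (D i)"
      using assms(1,2) by auto
    then show "level_factor (\<rho> i) (\<rho>h i) (D i) (i \<le> p) (i \<le> q) (i \<le> p') (i \<le> q')
        * level_factor (\<rho> i) (\<rho>h i) (D i) (i \<le> p') (i \<le> q') (i \<le> p'') (i \<le> q'')
      \<le> level_factor (\<rho> i) (\<rho>h i) (D i) (i \<le> p) (i \<le> q) (i \<le> p'') (i \<le> q'')"
      using assms(3-6) by (auto simp: level_factor_def mult.commute)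
  qed
qed

lemma cell_count_submult:
  assumes "\<And>i. i \<ge> 1 \<Longrightarrow> card (D i) \<le> \<rho> i * row_num (D i)"
    and "\<And>i. i \<ge> 1 \<Longrightarrow> card (D i) \<le> \<rho>h i * col_num (D i)"
    and "p \<le> p'" "q \<le> q'" "p' \<le> p''" "q' \<le> q''"
  shows "cell_count \<rho> \<rho>h D p q p'' q'' \<le> cell_count \<rho> \<rho>h D p q p' q' * cell_count \<rho> \<rho>h D p' q' p'' q''"
proof -
  let ?K = "max p'' q''"
  have K: "max p' q' \<le> ?K" "max p'' q'' \<le> ?K" "p \<le> p''" "q \<le> q''" using assms by auto
  show ?thesis
    unfolding cell_count_eq_prod[OF assms(3,4) K(1)] cell_count_eq_prod[OF assms(5,6) K(2)]
      cell_count_eq_prod[OF K(3,4,2)] prod.distrib[symmetric]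
  proof (rule prod_mono, safe)
    fix i assume "i \<in> {1..?K}"
    then have "card (D i) \<le> \<rho> i * row_num (D i)" "card (D i) \<le> \<rho>h i * col_num (D i)"
      using assms(1,2) by auto
    then show "level_factor (\<rho> i) (\<rho>h i) (D i) (i \<le> p) (i \<le> q) (i \<le> p'') (i \<le> q'')
      \<le> level_factor (\<rho> i) (\<rho>h i) (D i) (i \<le> p) (i \<le> q) (i \<le> p') (i \<le> q')
        * level_factor (\<rho> i) (\<rho>h i) (D i) (i \<le> p') (i \<le> q') (i \<le> p'') (i \<le> q'')"
      using assms(3-6) by (auto simp: level_factor_def mult.commute)
  qed
qed

text \<open>Padding with ones gives all products a common range, so that they can be compared
  position by position.\<close>

lemma prod_interval_eq_if:
  fixes f :: "nat \<Rightarrow> 'a::comm_monoid_mult"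
  assumes "b \<le> K"
  shows "(\<Prod>i=a+1..b. f i) = (\<Prod>i=1..K. if a < i \<and> i \<le> b then f i else 1)"
proof -
  have "{a+1..b} = {i \<in> {1..K}. a < i \<and> i \<le> b}" using assms by auto
  then show ?thesis by (simp only: prod.inter_filter finite_atLeastAtMost)
qed

text \<open>Once padded to a common range, every branch has the same factor at each position. The
  horizontal depths \<open>l\<close>, \<open>l'\<close> come before the vertical depths
  \<open>k\<close>, \<open>k'\<close> in \<open>cell_count\<close>.\<close>

lemma moran_N_aux_eq_cell_count:
  assumes "l \<le> l'" "k < k'"
  shows "moran_N_aux \<rho> \<rho>h D k k' l l' = cell_count \<rho> \<rho>h D l k l' k'"
proof -
  define K where "K = max l' k'"
  have le: "l \<le> K" "k \<le> K" "l' \<le> K" "k' \<le> K" using assms by (auto simp: K_def)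
  note e = prod_interval_eq_if[OF le(1)] prod_interval_eq_if[OF le(2)]
    prod_interval_eq_if[OF le(3)] prod_interval_eq_if[OF le(4)]
  show ?thesis
    unfolding moran_N_aux_def Let_def cell_count_def K_def[symmetric] e prod.distrib[symmetric]
    by (split if_split, intro conjI impI,
        (rule prod.cong[OF refl], use assms in \<open>auto simp: level_factor_def\<close>)[])+
      (rule prod.cong[OF refl], use assms in \<open>auto simp: level_factor_def\<close>)
qed


section \<open>One digit set\<close>

lemma row_num_eq: "row_num A = card (snd ` A)"
  unfolding row_num_def by (rule arg_cong[of _ _ card]) force

lemma col_num_eq: "col_num A = card (fst ` A)"
  unfolding col_num_def by (rule arg_cong[of _ _ card]) force

lemma row_card_eq: "row_card A j = card {v \<in> A. snd v = j}"
proof -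
  have "{v \<in> A. snd v = j} = (\<lambda>i. (i, j)) ` {i. (i, j) \<in> A}" by force
  then show ?thesis by (simp add: row_card_def card_image inj_on_def)
qed

text \<open>Start of the transfer by \<open>prod.swap\<close>: the extremal properties are proved
  for rows and carried over to columns.\<close>

lemma col_card_eq_row_card_swap: "col_card A i = row_card (prod.swap ` A) i"
  by (auto simp: col_card_def row_card_def intro!: arg_cong[of _ _ card])

lemma row_num_swap: "row_num (prod.swap ` A) = col_num A"
  by (simp add: row_num_eq col_num_eq image_image)

lemma col_max_eq_row_max_swap: "col_max a A = row_max a (prod.swap ` A)"
  by (simp add: col_max_def row_max_def col_card_eq_row_card_swap[abs_def])

lemma col_min_eq_row_min_swap: "col_min A = row_min (prod.swap ` A)"
  by (simp add: col_min_def row_min_def col_card_eq_row_card_swap)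

lemma card_swap: "card (prod.swap ` A) = card A"
  by (simp add: card_image)

lemma col_card_eq: "col_card A i = card {v \<in> A. fst v = i}"
proof -
  have "{v \<in> prod.swap ` A. snd v = i} = prod.swap ` {v \<in> A. fst v = i}" by force
  then show ?thesis by (simp add: col_card_eq_row_card_swap row_card_eq card_swap)
qed

lemma card_eq_sum_row_card:
  assumes "finite A"
  shows "card A = (\<Sum>j\<in>snd ` A. row_card A j)"
  using sum.image_gen[OF assms, of "\<lambda>_. 1::nat" snd] by (simp add: row_card_eq)

lemma row_card_eq_0_iff: "finite A \<Longrightarrow> row_card A j = 0 \<longleftrightarrow> j \<notin> snd ` A"
  unfolding row_card_eq by (subst card_0_eq) (simp, force)

lemma row_min_le:
  assumes "finite A" "j \<in> snd ` A"
  shows "row_min A \<le> row_card A j"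
proof -
  have "{row_card A j |j. row_card A j \<noteq> 0} \<subseteq> row_card A ` snd ` A"
    using assms(1) by (auto simp: row_card_eq_0_iff)
  then have "finite {row_card A j |j. row_card A j \<noteq> 0}" using assms(1) finite_subset by blast
  then show ?thesis unfolding row_min_def
    by (rule Min_le) (use assms row_card_eq_0_iff in blast)
qed

lemma row_min_attained:
  assumes "finite A" "A \<noteq> {}"
  shows "\<exists>w\<in>A. row_card A (snd w) = row_min A"
proof -
  let ?S = "{row_card A j |j. row_card A j \<noteq> 0}"
  have "?S \<subseteq> row_card A ` snd ` A"
    using assms(1) by (auto simp: row_card_eq_0_iff)
  then have fin: "finite ?S" using assms(1) finite_subset by blast
  have ne: "?S \<noteq> {}" using assms row_card_eq_0_iff by blast
  from Min_in[OF fin ne] obtain j where j: "row_min A = row_card A j" "row_card A j \<noteq> 0"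
    unfolding row_min_def by blast
  then have "j \<in> snd ` A" by (simp add: row_card_eq_0_iff[OF assms(1)])
  then show ?thesis unfolding j(1) by blast
qed

lemma row_max_ge:
  assumes "A \<subseteq> {0..a - 1} \<times> {0..b - 1}" "j \<in> snd ` A"
  shows "row_card A j \<le> row_max b A"
  unfolding row_max_def by (rule Max_ge) (use assms in auto)

lemma row_max_attained:
  assumes "A \<subseteq> {0..a - 1} \<times> {0..b - 1}" "A \<noteq> {}"
  shows "\<exists>w\<in>A. row_card A (snd w) = row_max b A"
proof -
  have fin: "finite A" using assms finite_subset by blast
  obtain v where v: "v \<in> A" using assms by blast
  \<comment> \<open>This maximum also ranges over empty rows; comparison with the occupied row of
    \<open>v\<close> shows that a maximising row is occupied.\<close>
  have "row_max b A \<in> row_card A ` {0..b - 1}" unfolding row_max_def by (rule Max_in) auto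
  then obtain j where j: "row_max b A = row_card A j" by auto
  have "row_card A (snd v) \<noteq> 0" using v by (simp add: row_card_eq_0_iff[OF fin])
  moreover have "row_card A (snd v) \<le> row_card A j"
    using row_max_ge[OF assms(1) imageI[OF v]] by (simp only: j)
  ultimately have "row_card A j \<noteq> 0" by linarith
  then have "j \<in> snd ` A" by (simp add: row_card_eq_0_iff[OF fin])
  then show ?thesis unfolding j by blast
qed

lemma row_min_mult_row_num_le:
  assumes "finite A"
  shows "row_min A * row_num A \<le> card A"
  unfolding card_eq_sum_row_card[OF assms] row_num_eq
  using sum_bounded_below[of "snd ` A" "row_min A" "row_card A"] row_min_le[OF assms]
  by (simp add: mult.commute)

lemma card_le_row_max_mult_row_num:
  assumes "A \<subseteq> {0..a - 1} \<times> {0..b - 1}"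
  shows "card A \<le> row_max b A * row_num A"
proof -
  have "finite A" using assms finite_subset by blast
  then show ?thesis
    unfolding card_eq_sum_row_card[OF \<open>finite A\<close>] row_num_eq
    using sum_bounded_above[of "snd ` A" "row_card A" "row_max b A"] row_max_ge[OF assms]
    by (simp add: mult.commute)
qed

lemma swap_subset_Times: "A \<subseteq> S \<times> T \<Longrightarrow> prod.swap ` A \<subseteq> T \<times> S"
  by auto

lemma col_min_le: "finite A \<Longrightarrow> i \<in> fst ` A \<Longrightarrow> col_min A \<le> col_card A i"
  using row_min_le[of "prod.swap ` A" i]
  by (simp add: col_min_eq_row_min_swap col_card_eq_row_card_swap image_image)

lemma col_min_attained:
  "finite A \<Longrightarrow> A \<noteq> {} \<Longrightarrow> \<exists>w\<in>A. col_card A (fst w) = col_min A"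
  using row_min_attained[of "prod.swap ` A"]
  by (simp add: col_min_eq_row_min_swap col_card_eq_row_card_swap)

lemma col_max_ge:
  assumes "A \<subseteq> {0..a - 1} \<times> {0..b - 1}" "i \<in> fst ` A"
  shows "col_card A i \<le> col_max a A"
  using row_max_ge[OF swap_subset_Times[OF assms(1)], of i] assms(2)
  by (simp add: col_max_eq_row_max_swap col_card_eq_row_card_swap image_image)

lemma col_max_attained:
  assumes "A \<subseteq> {0..a - 1} \<times> {0..b - 1}" "A \<noteq> {}"
  shows "\<exists>w\<in>A. col_card A (fst w) = col_max a A"
  using row_max_attained[OF swap_subset_Times[OF assms(1)]] assms(2)
  by (simp add: col_max_eq_row_max_swap col_card_eq_row_card_swap)

lemma col_min_mult_col_num_le: "finite A \<Longrightarrow> col_min A * col_num A \<le> card A"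
  using row_min_mult_row_num_le[of "prod.swap ` A"]
  by (simp add: col_min_eq_row_min_swap row_num_swap card_swap)

lemma card_le_col_max_mult_col_num:
  assumes "A \<subseteq> {0..a - 1} \<times> {0..b - 1}"
  shows "card A \<le> col_max a A * col_num A"
  using card_le_row_max_mult_row_num[OF swap_subset_Times[OF assms]]
  by (simp add: col_max_eq_row_max_swap row_num_swap card_swap)

text \<open>Replacing a coordinate that the subcell does not see by 0 identifies exactly the digits
  that lead to the same subcell.\<close>

lemma card_extensions_eq_level_factor:
  assumes "finite A" "w \<in> A" "a \<longrightarrow> a'" "b \<longrightarrow> b'"
  shows "card ((\<lambda>v. (if a' then fst v else 0 :: nat, if b' then snd v else 0 :: nat)) `
      {v \<in> A. (a \<longrightarrow> fst v = fst w) \<and> (b \<longrightarrow> snd v = snd w)})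
    = level_factor (row_card A (snd w)) (col_card A (fst w)) A a b a' b'"
proof -
  have 1: "card ((\<lambda>v. (fst v, 0 :: nat)) ` A) = col_num A" for A :: "(nat \<times> nat) set"
  proof -
    have "(\<lambda>v. (fst v, 0 :: nat)) ` A = (\<lambda>x. (x, 0)) ` fst ` A" by auto
    then show ?thesis by (simp add: col_num_eq card_image inj_on_def)
  qed
  have 2: "card ((\<lambda>v. (0 :: nat, snd v)) ` A) = row_num A" for A :: "(nat \<times> nat) set"
  proof -
    have "(\<lambda>v. (0 :: nat, snd v)) ` A = (\<lambda>x. (0, x)) ` snd ` A" by auto
    then show ?thesis by (simp add: row_num_eq card_image inj_on_def)
  qed
  have 3: "{v \<in> A. fst v = fst w \<and> snd v = snd w} = {w}" using assms(2) by (auto simp: prod_eq_iff)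
  have 4: "(\<lambda>v. (0 :: nat, 0 :: nat)) ` A = {(0, 0)}" using assms(2) by auto
  have 5: "card ((\<lambda>v. (fst w, snd v)) ` {v \<in> A. fst v = fst w}) = card {v \<in> A. fst v = fst w}"
    by (rule card_image) (auto simp: inj_on_def prod_eq_iff)
  have 6: "card ((\<lambda>v. (fst v, snd w)) ` {v \<in> A. snd v = snd w}) = card {v \<in> A. snd v = snd w}"
    by (rule card_image) (auto simp: inj_on_def prod_eq_iff)
  have 7: "(\<lambda>v. (fst w, 0 :: nat)) ` {v \<in> A. fst v = fst w} = {(fst w, 0)}"
    "(\<lambda>v. (0 :: nat, snd w)) ` {v \<in> A. snd v = snd w} = {(0, snd w)}"
    using assms(2) by auto
  show ?thesis
    by (cases a; cases b; cases a'; cases b')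
      (use assms(3,4) in \<open>simp_all add: level_factor_def row_card_eq col_card_eq 1 2 3 4 5 6 7\<close>)
qed


section \<open>Words and cells\<close>

text \<open>\<open>L\<close> is a common bound for both sequences. The locale form allows a second
  interpretation with the coordinates exchanged.\<close>

locale moran =
  fixes n m :: "nat \<Rightarrow> nat" and D :: "nat \<Rightarrow> (nat \<times> nat) set" and L :: nat
  assumes n_bounds: "k \<ge> 1 \<Longrightarrow> 2 \<le> n k \<and> n k \<le> L"
    and m_bounds: "k \<ge> 1 \<Longrightarrow> 2 \<le> m k \<and> m k \<le> L"
    and digits_subset: "k \<ge> 1 \<Longrightarrow> D k \<subseteq> {0..n k - 1} \<times> {0..m k - 1}"
    and digits_nonempty: "k \<ge> 1 \<Longrightarrow> D k \<noteq> {}"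
begin

definition words :: "(nat \<Rightarrow> nat \<times> nat) set" where
  "words = {w. \<forall>i\<ge>1. w i \<in> D i}"

abbreviation X :: "(nat \<Rightarrow> nat \<times> nat) \<Rightarrow> nat \<Rightarrow> nat" where "X w \<equiv> code n (fst \<circ> w)"
abbreviation Y :: "(nat \<Rightarrow> nat \<times> nat) \<Rightarrow> nat \<Rightarrow> nat" where "Y w \<equiv> code m (snd \<circ> w)"

text \<open>Cells are recorded by their codes rather than as sets of points, which makes counting
  purely combinatorial although closed cells overlap in their boundaries.\<close>

definition subcells :: "nat \<Rightarrow> nat \<Rightarrow> nat \<Rightarrow> nat \<Rightarrow> (nat \<Rightarrow> nat \<times> nat) \<Rightarrow> (nat \<times> nat) set" where
  "subcells p q p' q' w = (\<lambda>v. (X v p', Y v q')) ` {v \<in> words. X v p = X w p \<and> Y v q = Y w q}"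

lemma finite_digits: "k \<ge> 1 \<Longrightarrow> finite (D k)"
  using finite_subset[OF digits_subset[of k]] by simp

lemma digit_less: "v \<in> D k \<Longrightarrow> k \<ge> 1 \<Longrightarrow> fst v < n k \<and> snd v < m k"
  using digits_subset[of k] n_bounds[of k] m_bounds[of k] by (cases v) auto

lemma words_digit: "w \<in> words \<Longrightarrow> i \<ge> 1 \<Longrightarrow> w i \<in> D i"
  by (simp add: words_def)

lemma words_less: "w \<in> words \<Longrightarrow> i \<ge> 1 \<Longrightarrow> fst (w i) < n i \<and> snd (w i) < m i"
  using digit_less words_digit by blast

lemma X_inj: "v \<in> words \<Longrightarrow> w \<in> words \<Longrightarrow> X v p = X w p \<Longrightarrow> 1 \<le> i \<Longrightarrow> i \<le> p \<Longrightarrow> fst (v i) = fst (w i)"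
  using code_inj[of p "fst \<circ> v" n "fst \<circ> w" i] words_less by auto

lemma Y_inj: "v \<in> words \<Longrightarrow> w \<in> words \<Longrightarrow> Y v p = Y w p \<Longrightarrow> 1 \<le> i \<Longrightarrow> i \<le> p \<Longrightarrow> snd (v i) = snd (w i)"
  using code_inj[of p "snd \<circ> v" m "snd \<circ> w" i] words_less by auto

text \<open>Digits at different positions are chosen independently, so the codes correspond to a
  finite product of masked digit sets, one for each position.\<close>

lemma card_subcells:
  assumes w: "w \<in> words" and le: "p \<le> p'" "q \<le> q'"
  shows "finite (subcells p q p' q' w)"
    and "card (subcells p q p' q' w) =
      cell_count (\<lambda>i. row_card (D i) (snd (w i))) (\<lambda>i. col_card (D i) (fst (w i))) D p q p' q'"
proof -
  define K where "K = max p' q'"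
  define \<psi> where "\<psi> = (\<lambda>i (v :: nat \<times> nat). (if i \<le> p' then fst v else 0 :: nat, if i \<le> q' then snd v else 0 :: nat))"
  define V where "V = (\<lambda>i. {v \<in> D i. (i \<le> p \<longrightarrow> fst v = fst (w i)) \<and> (i \<le> q \<longrightarrow> snd v = snd (w i))})"
  define P where "P = (\<Pi>\<^sub>E i\<in>{1..K}. \<psi> i ` V i)"
  define H where "H = (\<lambda>f :: nat \<Rightarrow> nat \<times> nat. (X f p', Y f q'))"
  have K: "p' \<le> K" "q' \<le> K" "p \<le> K" "q \<le> K" using le by (auto simp: K_def)
  have P_image: "f i \<in> \<psi> i ` V i" if "f \<in> P" "i \<in> {1..K}" for f i
    using PiE_mem[OF that[unfolded P_def]] .
  have P_less: "fst (f i) < n i \<and> snd (f i) < m i" if f: "f \<in> P" "i \<in> {1..K}" for f i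
  proof -
    obtain v where "v \<in> D i" "f i = \<psi> i v" using P_image[OF f] unfolding V_def by blast
    then show ?thesis using digit_less[of v i] f(2) by (auto simp: \<psi>_def)
  qed
  \<comment> \<open>Visible coordinates are recovered from the codes; hidden ones are 0 in both
    functions.\<close>
  have inj: "inj_on H P"
  proof (rule inj_onI)
    fix f g assume fg: "f \<in> P" "g \<in> P" and eq: "H f = H g"
    have "f i = g i" if i: "i \<in> {1..K}" for i
    proof -
      obtain u v where uv: "f i = \<psi> i u" "g i = \<psi> i v" using P_image[OF fg(1) i] P_image[OF fg(2) i] by blast
      have "fst (f i) = fst (g i)"
      proof (cases "i \<le> p'")
        case True
        then show ?thesis
          using code_inj[of p' "fst \<circ> f" n "fst \<circ> g" i] eq P_less fg i K by (auto simp: H_def)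
      qed (simp add: uv \<psi>_def)
      moreover have "snd (f i) = snd (g i)"
      proof (cases "i \<le> q'")
        case True
        then show ?thesis
          using code_inj[of q' "snd \<circ> f" m "snd \<circ> g" i] eq P_less fg i K by (auto simp: H_def)
      qed (simp add: uv \<psi>_def)
      ultimately show ?thesis by (simp add: prod_eq_iff)
    qed
    then show "f = g" using fg PiE_ext unfolding P_def by blast
  qed
  have img: "subcells p q p' q' w = H ` P"
  proof (intro subset_antisym subsetI)
    fix c assume "c \<in> subcells p q p' q' w"
    then obtain v where v: "v \<in> words" "X v p = X w p" "Y v q = Y w q" "c = (X v p', Y v q')"
      by (auto simp: subcells_def)
    let ?f = "restrict (\<lambda>i. \<psi> i (v i)) {1..K}"
    have "v i \<in> V i" if "i \<in> {1..K}" for i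
      using that v w X_inj[of v w p i] Y_inj[of v w q i] by (auto simp: V_def words_digit)
    then have "?f \<in> P" by (auto simp: P_def)
    moreover have "H ?f = c"
      using K by (auto simp: H_def v(4) \<psi>_def intro!: code_cong)
    ultimately show "c \<in> H ` P" by blast
  next
    fix c assume "c \<in> H ` P"
    then obtain f where f: "f \<in> P" "c = H f" by blast
    have "\<forall>i\<in>{1..K}. \<exists>v. v \<in> V i \<and> f i = \<psi> i v" using P_image[OF f(1)] by blast
    then obtain v where v: "\<And>i. i \<in> {1..K} \<Longrightarrow> v i \<in> V i \<and> f i = \<psi> i (v i)" by metis
    \<comment> \<open>Beyond the positions that matter, \<open>w\<close> supplies the digits of an
      infinite admissible word.\<close>
    define u where "u = (\<lambda>i. if i \<in> {1..K} then v i else w i)"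
    have "u \<in> words" using v w by (auto simp: words_def u_def V_def)
    moreover have "X u p = X w p" "Y u q = Y w q"
      using v K by (auto simp: u_def V_def intro!: code_cong)
    moreover have "c = (X u p', Y u q')"
      using v K f(2) by (auto simp: H_def u_def \<psi>_def intro!: code_cong)
    ultimately show "c \<in> subcells p q p' q' w" by (auto simp: subcells_def)
  qed
  have "finite P" unfolding P_def
    by (rule finite_PiE) (auto simp: V_def finite_digits)
  then show "finite (subcells p q p' q' w)" by (simp add: img)
  have "card (subcells p q p' q' w) = (\<Prod>i\<in>{1..K}. card (\<psi> i ` V i))"
    unfolding img card_image[OF inj] by (simp add: P_def card_PiE)
  also have "\<dots> = (\<Prod>i\<in>{1..K}. level_factor (row_card (D i) (snd (w i))) (col_card (D i) (fst (w i))) (D i)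
      (i \<le> p) (i \<le> q) (i \<le> p') (i \<le> q'))"
  proof (rule prod.cong[OF refl])
    fix i assume "i \<in> {1..K}"
    then show "card (\<psi> i ` V i) = level_factor (row_card (D i) (snd (w i))) (col_card (D i) (fst (w i))) (D i)
      (i \<le> p) (i \<le> q) (i \<le> p') (i \<le> q')"
      unfolding \<psi>_def V_def
      using le by (intro card_extensions_eq_level_factor) (auto simp: finite_digits words_digit[OF w])
  qed
  finally show "card (subcells p q p' q' w) =
      cell_count (\<lambda>i. row_card (D i) (snd (w i))) (\<lambda>i. col_card (D i) (fst (w i))) D p q p' q'"
    by (simp add: cell_count_def K_def)
qed

lemma card_subcells_ge:
  assumes w: "w \<in> words" "p \<le> p'" "q \<le> q'"
  shows "cell_count (\<lambda>i. row_min (D i)) (\<lambda>i. col_min (D i)) D p q p' q' \<le> card (subcells p q p' q' w)"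
  unfolding card_subcells(2)[OF assms]
  by (rule cell_count_mono)
    (auto intro!: row_min_le col_min_le imageI words_digit[OF w(1)] simp: finite_digits)

lemma card_subcells_le:
  assumes w: "w \<in> words" "p \<le> p'" "q \<le> q'"
  shows "card (subcells p q p' q' w)
    \<le> cell_count (\<lambda>i. row_max (m i) (D i)) (\<lambda>i. col_max (n i) (D i)) D p q p' q'"
  unfolding card_subcells(2)[OF assms]
  by (rule cell_count_mono)
    (auto intro!: row_max_ge[OF digits_subset] col_max_ge[OF digits_subset] imageI words_digit[OF w(1)])

text \<open>The rows are separated two levels deeper than needed.  This fixes the rows of the levels \<open>p + 1\<close> and
  \<open>p + 2\<close> for all close words, so that least and greatest column digits can be taken within these rows.\<close>

lemma separated_word_rows:
  assumes "p \<le> q" and w0: "w0 \<in> words"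
  shows "\<exists>w\<in>words. (\<forall>i. i \<le> q \<longrightarrow> snd (w i) = snd (w0 i)) \<and>
    (\<forall>v\<in>words. \<bar>int (X v (p+2)) - int (X w (p+2))\<bar> \<le> 1 \<longrightarrow> \<bar>int (Y v (q+4)) - int (Y w (q+4))\<bar> \<le> 1 \<longrightarrow>
      X v p = X w p \<and> Y v q = Y w q)"
proof -
  \<comment> \<open>The rows up to \<open>q\<close>, on which the count depends when
    \<open>p \<le> q\<close>, are kept. In \<open>x\<close> below only the positions
    \<open>p + 1\<close> and \<open>p + 2\<close> matter; elsewhere \<open>Max\<close> is just some
    admissible column for the prescribed row.\<close>
  define y where "y = (\<lambda>i. if i = q+3 then Min (snd ` D i) else if i = q+4 then Max (snd ` D i) else snd (w0 i))"
  define A where "A = (\<lambda>i. {a. (a, y i) \<in> D i})"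
  define x where "x = (\<lambda>i. if i = p+1 then Min (A i) else Max (A i))"
  define w where "w = (\<lambda>i. (x i, y i))"
  have y: "y i \<in> snd ` D i" if "i \<ge> 1" for i
  proof -
    have "finite (snd ` D i)" "snd ` D i \<noteq> {}" using that by (auto simp: finite_digits digits_nonempty)
    then show ?thesis using words_digit[OF w0 that] Min_in Max_in by (auto simp: y_def)
  qed
  have A: "finite (A i)" "A i \<noteq> {}" if "i \<ge> 1" for i
  proof -
    have "A i \<subseteq> fst ` D i" by (force simp: A_def)
    then show "finite (A i)" using finite_digits[OF that] finite_subset by blast
    show "A i \<noteq> {}" using y[OF that] by (auto simp: A_def)
  qed
  have "x i \<in> A i" if "i \<ge> 1" for i using Min_in[OF A[OF that]] Max_in[OF A[OF that]] by (cases "i = p+1") (simp_all add: x_def)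
  then have w: "w \<in> words" by (auto simp: words_def w_def A_def)
  have "X v p = X w p \<and> Y v q = Y w q"
    if v: "v \<in> words" and cx: "\<bar>int (X v (p+2)) - int (X w (p+2))\<bar> \<le> 1"
      and cy: "\<bar>int (Y v (q+4)) - int (Y w (q+4))\<bar> \<le> 1" for v
  proof -
    have fin: "finite (snd ` D i)" if "i \<ge> 1" for i using that by (simp add: finite_digits)
    have vD: "v i \<in> D i" if "i \<ge> 1" for i using v that by (rule words_digit)
    have lt: "fst (v i) < n i" "snd (v i) < m i" "x i < n i" "y i < m i" if "i \<ge> 1" for i
      using words_less[OF v that] words_less[OF w that] by (simp_all add: w_def)
    have "Y v (q+2) = Y w (q+2)"
    proof (rule code_separation)
      have "q+2+2 = q+4" by simp
      with cy show "\<bar>int (Y v (q+2+2)) - int (Y w (q+2+2))\<bar> \<le> 1" by (simp only:)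
      show "(snd \<circ> w) (q+2+1) \<le> (snd \<circ> v) (q+2+1)"
        using fin[of "q+3"] vD[of "q+3"] by (auto simp: w_def y_def add.commute numeral_3_eq_3)
      have "snd (v (q+4)) \<le> Max (snd ` D (q+4))" by (intro Max_ge fin imageI vD) auto
      then show "(snd \<circ> v) (q+2+2) \<le> (snd \<circ> w) (q+2+2)"
        by (simp add: w_def y_def \<open>q+2+2 = q+4\<close> del: add_2_eq_Suc')
    qed (use m_bounds lt in \<open>auto simp: w_def\<close>)
    then have eqy: "snd (v i) = y i" if "i \<ge> 1" "i \<le> q + 2" for i
      using Y_inj[OF v w _ that] by (simp add: w_def)
    \<comment> \<open>Since \<open>p \<le> q\<close>, this covers the positions \<open>p + 1\<close>
      and \<open>p + 2\<close>, where \<open>v\<close> can now be compared with the extreme columns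
      of the same row.\<close>
    then have vA: "fst (v i) \<in> A i" if "i \<ge> 1" "i \<le> q + 2" for i
      using that vD[OF that(1)] by (metis A_def mem_Collect_eq prod.collapse)
    have "X v p = X w p"
    proof (rule code_separation[OF _ _ _ _ _ _ cx])
      show "(fst \<circ> w) (p+1) \<le> (fst \<circ> v) (p+1)"
        using A[of "p+1"] vA[of "p+1"] \<open>p \<le> q\<close> by (auto simp: w_def x_def)
      show "(fst \<circ> v) (p+2) \<le> (fst \<circ> w) (p+2)"
        using A[of "p+2"] vA[of "p+2"] \<open>p \<le> q\<close> by (auto simp: w_def x_def)
    qed (use n_bounds lt in \<open>auto simp: w_def\<close>)
    moreover have "Y v q = Y w q" using eqy by (auto simp: w_def intro!: code_cong)
    ultimately show ?thesis by blast
  qed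
  moreover have "snd (w i) = snd (w0 i)" if "i \<le> q" for i using that by (simp add: w_def y_def)
  ultimately show ?thesis using w by blast
qed

lemma swap_moran: "moran m n (\<lambda>i. prod.swap ` D i) L"
proof
  fix k :: nat assume k: "k \<ge> 1"
  show "prod.swap ` D k \<subseteq> {0..m k - 1} \<times> {0..n k - 1}" using swap_subset_Times[OF digits_subset[OF k]] .
qed (use n_bounds m_bounds digits_nonempty in auto)

text \<open>The row version read in the construction with exchanged coordinates.\<close>

lemma separated_word_cols:
  assumes "q \<le> p" and w0: "w0 \<in> words"
  shows "\<exists>w\<in>words. (\<forall>i. i \<le> p \<longrightarrow> fst (w i) = fst (w0 i)) \<and>
    (\<forall>v\<in>words. \<bar>int (X v (p+4)) - int (X w (p+4))\<bar> \<le> 1 \<longrightarrow> \<bar>int (Y v (q+2)) - int (Y w (q+2))\<bar> \<le> 1 \<longrightarrow>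
      X v p = X w p \<and> Y v q = Y w q)"
proof -
  interpret sw: moran m n "\<lambda>i. prod.swap ` D i" L by (rule swap_moran)
  have mem: "prod.swap \<circ> v \<in> sw.words" if "v \<in> words" for v
    using that by (auto simp: words_def sw.words_def)
  have mem': "prod.swap \<circ> v \<in> words" if "v \<in> sw.words" for v
    using that by (force simp: words_def sw.words_def)
  have fs: "fst \<circ> (prod.swap \<circ> v) = snd \<circ> v" "snd \<circ> (prod.swap \<circ> v) = fst \<circ> v" for v :: "nat \<Rightarrow> nat \<times> nat"
    by auto
  obtain w where w: "w \<in> sw.words" "\<And>i. i \<le> p \<Longrightarrow> snd (w i) = snd ((prod.swap \<circ> w0) i)"
    and sep: "\<And>v. v \<in> sw.words \<Longrightarrow> \<bar>int (sw.X v (q+2)) - int (sw.X w (q+2))\<bar> \<le> 1 \<Longrightarrow>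
      \<bar>int (sw.Y v (p+4)) - int (sw.Y w (p+4))\<bar> \<le> 1 \<Longrightarrow> sw.X v q = sw.X w q \<and> sw.Y v p = sw.Y w p"
    using sw.separated_word_rows[OF assms(1) mem[OF w0]] by blast
  show ?thesis
    by (rule bexI[OF _ mem'[OF w(1)]]) (use w(2) sep[OF mem] in \<open>auto simp: fs\<close>)
qed

text \<open>For \<open>p \<le> q\<close> the count sees only row fibres at positions up to
  \<open>q\<close>, so \<open>w0\<close> is chosen by \<open>\<rho>\<close>; for
  \<open>p > q\<close> only column fibres matter and \<open>\<rho>h\<close> is used. Closeness is
  required at all offsets up to 4 so that one hypothesis supplies the offsets 2 and 4 in either
  order.\<close>

lemma separated_word:
  assumes le: "p \<le> p'" "q \<le> q'"
    and \<rho>: "\<And>i. i \<ge> 1 \<Longrightarrow> \<exists>w\<in>D i. row_card (D i) (snd w) = \<rho> i"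
    and \<rho>h: "\<And>i. i \<ge> 1 \<Longrightarrow> \<exists>w\<in>D i. col_card (D i) (fst w) = \<rho>h i"
  shows "\<exists>w\<in>words. card (subcells p q p' q' w) = cell_count \<rho> \<rho>h D p q p' q' \<and>
    (\<forall>v\<in>words. (\<forall>j\<le>4. \<bar>int (X v (p+j)) - int (X w (p+j))\<bar> \<le> 1 \<and> \<bar>int (Y v (q+j)) - int (Y w (q+j))\<bar> \<le> 1)
      \<longrightarrow> X v p = X w p \<and> Y v q = Y w q)"
proof (cases "p \<le> q")
  case True
  obtain w0 where w0: "\<And>i. i \<ge> 1 \<Longrightarrow> w0 i \<in> D i \<and> row_card (D i) (snd (w0 i)) = \<rho> i"
    using \<rho> by metis
  then have "w0 \<in> words" by (simp add: words_def)
  from separated_word_rows[OF True this] obtain w where w: "w \<in> words"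
    "\<And>i. i \<le> q \<Longrightarrow> snd (w i) = snd (w0 i)"
    and sep: "\<And>v. v \<in> words \<Longrightarrow> \<bar>int (X v (p+2)) - int (X w (p+2))\<bar> \<le> 1 \<Longrightarrow>
      \<bar>int (Y v (q+4)) - int (Y w (q+4))\<bar> \<le> 1 \<Longrightarrow> X v p = X w p \<and> Y v q = Y w q"
    by blast
  have "card (subcells p q p' q' w) = cell_count \<rho> \<rho>h D p q p' q'"
    unfolding card_subcells(2)[OF w(1) le] cell_count_def
    by (intro prod.cong level_factor_cong) (use True w(2) w0 in auto)
  moreover have "X v p = X w p \<and> Y v q = Y w q" if "v \<in> words"
    "\<forall>j\<le>4. \<bar>int (X v (p+j)) - int (X w (p+j))\<bar> \<le> 1 \<and> \<bar>int (Y v (q+j)) - int (Y w (q+j))\<bar> \<le> 1" for v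
  proof -
    have "2 \<le> (4::nat)" by simp
    then show ?thesis using sep[OF that(1)] that(2) order_refl[of "4::nat"] by blast
  qed
  ultimately show ?thesis using w(1) by blast
next
  case False
  obtain w0 where w0: "\<And>i. i \<ge> 1 \<Longrightarrow> w0 i \<in> D i \<and> col_card (D i) (fst (w0 i)) = \<rho>h i"
    using \<rho>h by metis
  then have "w0 \<in> words" by (simp add: words_def)
  then obtain w where w: "w \<in> words"
    "\<And>i. i \<le> p \<Longrightarrow> fst (w i) = fst (w0 i)"
    and sep: "\<And>v. v \<in> words \<Longrightarrow> \<bar>int (X v (p+4)) - int (X w (p+4))\<bar> \<le> 1 \<Longrightarrow>
      \<bar>int (Y v (q+2)) - int (Y w (q+2))\<bar> \<le> 1 \<Longrightarrow> X v p = X w p \<and> Y v q = Y w q"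
    using separated_word_cols[of q p w0] False by auto
  have "card (subcells p q p' q' w) = cell_count \<rho> \<rho>h D p q p' q'"
    unfolding card_subcells(2)[OF w(1) le] cell_count_def
    by (intro prod.cong level_factor_cong) (use False w(2) w0 in auto)
  moreover have "X v p = X w p \<and> Y v q = Y w q" if "v \<in> words"
    "\<forall>j\<le>4. \<bar>int (X v (p+j)) - int (X w (p+j))\<bar> \<le> 1 \<and> \<bar>int (Y v (q+j)) - int (Y w (q+j))\<bar> \<le> 1" for v
  proof -
    have "2 \<le> (4::nat)" by simp
    then show ?thesis using sep[OF that(1)] that(2) order_refl[of "4::nat"] by blast
  qed
  ultimately show ?thesis using w(1) by blast
qed

text \<open>Comparison with the full grid, where each newly seen coordinate contributes its base
  \<open>n i\<close> or \<open>m i\<close>.\<close>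

lemma cell_count_le:
  assumes le: "p \<le> p'" "q \<le> q'"
    and \<rho>: "\<And>i. i \<ge> 1 \<Longrightarrow> \<rho> i \<le> n i" and \<rho>h: "\<And>i. i \<ge> 1 \<Longrightarrow> \<rho>h i \<le> m i"
  shows "real (cell_count \<rho> \<rho>h D p q p' q') * (lev n p * lev m q) \<le> lev n p' * lev m q'"
proof -
  let ?K = "max p' q'"
  have "level_factor (\<rho> i) (\<rho>h i) (D i) (i \<le> p) (i \<le> q) (i \<le> p') (i \<le> q')
      \<le> (if p < i \<and> i \<le> p' then n i else 1) * (if q < i \<and> i \<le> q' then m i else 1)" if "i \<in> {1..?K}" for i
  proof -
    have i: "i \<ge> 1" using that by simp
    have 1: "fst ` D i \<subseteq> {..<n i}" "snd ` D i \<subseteq> {..<m i}" using digit_less[OF _ i] by auto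
    have "D i \<subseteq> {..<n i} \<times> {..<m i}" using digit_less[OF _ i] by force
    from card_mono[OF _ this] have "card (D i) \<le> n i * m i" by simp
    moreover have "col_num (D i) \<le> n i" "row_num (D i) \<le> m i"
      using card_mono[OF _ 1(1)] card_mono[OF _ 1(2)] by (simp_all add: col_num_eq row_num_eq)
    ultimately show ?thesis
      using \<rho>[OF i] \<rho>h[OF i] n_bounds[OF i] m_bounds[OF i] le by (auto simp: level_factor_def)
  qed
  then have "cell_count \<rho> \<rho>h D p q p' q' \<le>
      (\<Prod>i=1..?K. (if p < i \<and> i \<le> p' then n i else 1) * (if q < i \<and> i \<le> q' then m i else 1))"
    unfolding cell_count_def by (intro prod_mono) auto
  also have "\<dots> = (\<Prod>i=p+1..p'. n i) * (\<Prod>i=q+1..q'. m i)"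
    by (simp only: prod.distrib prod_interval_eq_if[of p' ?K n p] prod_interval_eq_if[of q' ?K m q] max.cobounded1 max.cobounded2)
  finally have "real (cell_count \<rho> \<rho>h D p q p' q') \<le> (\<Prod>i=p+1..p'. real (n i)) * (\<Prod>i=q+1..q'. real (m i))"
    by (metis of_nat_le_iff of_nat_mult of_nat_prod)
  moreover have "0 \<le> lev n p * lev m q" by (simp add: lev_def prod_nonneg)
  ultimately have "real (cell_count \<rho> \<rho>h D p q p' q') * (lev n p * lev m q)
      \<le> ((\<Prod>i=p+1..p'. real (n i)) * (\<Prod>i=q+1..q'. real (m i))) * (lev n p * lev m q)"
    by (rule mult_right_mono)
  also have "\<dots> = lev n p' * lev m q'"
    by (simp only: lev_split[OF le(1)] lev_split[OF le(2)] mult_ac)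
  finally show ?thesis .
qed


section \<open>Cells of the Moran set\<close>

abbreviation E :: "(real \<times> real) set" where "E \<equiv> moran_set n m D"

definition cell :: "nat \<Rightarrow> nat \<Rightarrow> nat \<times> nat \<Rightarrow> (real \<times> real) set" where
  "cell p q c = digit_int n p (fst c) \<times> digit_int m q (snd c)"

abbreviation wcell :: "(nat \<Rightarrow> nat \<times> nat) \<Rightarrow> nat \<Rightarrow> nat \<Rightarrow> (real \<times> real) set" where
  "wcell w p q \<equiv> cell p q (X w p, Y w q)"

lemma lev_pos: "lev n p > 0" "lev m p > 0"
  using lev_ge_1[of n p] lev_ge_1[of m p] n_bounds m_bounds by force+

lemma moran_comp_eq:
  "moran_comp n m w k x = ((real (X w k) + fst x) / lev n k, (real (Y w k) + snd x) / lev m k)"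
proof (induction k arbitrary: x)
  case (Suc k)
  have "n (Suc k) \<noteq> 0" "m (Suc k) \<noteq> 0" using n_bounds[of "Suc k"] m_bounds[of "Suc k"] by auto
  then show ?case
    using lev_pos[of k] by (simp add: Suc moran_map_def lev_Suc field_simps)
qed (simp add: prod_eq_iff)

lemma mem_wcell_iff: "z \<in> wcell w k k \<longleftrightarrow> z \<in> moran_comp n m w k ` ({0..1} \<times> {0..1})"
proof
  assume z: "z \<in> wcell w k k"
  let ?x = "(fst z * lev n k - X w k, snd z * lev m k - Y w k)"
  have "?x \<in> {0..1} \<times> {0..1}"
    using z lev_pos[of k] by (auto simp: cell_def mem_digit_int mem_Times_iff)
  moreover have "z = moran_comp n m w k ?x"
    using lev_pos[of k] by (simp add: moran_comp_eq prod_eq_iff)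
  ultimately show "z \<in> moran_comp n m w k ` ({0..1} \<times> {0..1})" by blast
next
  assume "z \<in> moran_comp n m w k ` ({0..1} \<times> {0..1})"
  then show "z \<in> wcell w k k"
    using lev_pos[of k] by (auto simp: moran_comp_eq cell_def mem_digit_int)
qed

lemma wcell_antimono:
  assumes "w \<in> words" "p \<le> p'" "q \<le> q'"
  shows "wcell w p' q' \<subseteq> wcell w p q"
  using digit_int_antimono[of n "fst \<circ> w", OF _ _ assms(2)] digit_int_antimono[of m "snd \<circ> w", OF _ _ assms(3)]
    n_bounds m_bounds words_less[OF assms(1)]
  by (simp add: cell_def Sigma_mono)

lemma some_digit: "k \<ge> 1 \<Longrightarrow> (SOME v. v \<in> D k) \<in> D k"
  by (simp add: some_in_eq digits_nonempty)

text \<open>The word may depend on \<open>K\<close>: membership at level \<open>Suc K\<close> and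
  nesting suffice, so no compactness argument for an infinite coding is required.\<close>

lemma ex_word_of_point:
  assumes "z \<in> E"
  shows "\<exists>w\<in>words. \<forall>p\<le>K. \<forall>q\<le>K. z \<in> wcell w p q"
proof -
  let ?k = "Suc K"
  have "?k \<in> {1..}" by simp
  with assms have "z \<in> (\<Union>w\<in>(\<Pi>\<^sub>E j\<in>{1..?k}. D j). moran_comp n m w ?k ` ({0..1} \<times> {0..1}))"
    unfolding moran_set_def by (rule INT_D)
  then obtain u where u: "u \<in> (\<Pi>\<^sub>E j\<in>{1..?k}. D j)" "z \<in> moran_comp n m u ?k ` ({0..1} \<times> {0..1})"
    by (rule UN_E)
  \<comment> \<open>The finite word is continued by arbitrary admissible digits; its codes up to
    \<open>?k\<close> are unchanged.\<close>
  define w where "w = (\<lambda>i. if i \<in> {1..?k} then u i else SOME v. v \<in> D i)"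
  have w: "w \<in> words"
    using u(1) some_digit by (auto simp: words_def w_def PiE_iff)
  have "X w ?k = X u ?k" "Y w ?k = Y u ?k" by (auto simp: w_def intro!: code_cong simp del: code.simps)
  then have "z \<in> wcell w ?k ?k" using u(2) mem_wcell_iff[where w = u and k = ?k] by (simp only:)
  then show ?thesis using wcell_antimono[OF w, of _ ?k _ ?k] w by (meson le_SucI subsetD)
qed

lemma ex_point_of_word:
  assumes w: "w \<in> words"
  shows "\<exists>z\<in>E. \<forall>p q. z \<in> wcell w p q"
proof -
  obtain s t where st: "\<And>p. s \<in> digit_int n p (X w p)" "\<And>p. t \<in> digit_int m p (Y w p)"
    using ex_point_of_digits[of n "fst \<circ> w"] ex_point_of_digits[of m "snd \<circ> w"]
      n_bounds m_bounds words_less[OF w] by auto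
  have z: "(s, t) \<in> wcell w p q" for p q using st by (simp add: cell_def)
  have "(s, t) \<in> (\<Union>w\<in>(\<Pi>\<^sub>E j\<in>{1..k}. D j). moran_comp n m w k ` ({0..1} \<times> {0..1}))" for k
  proof -
    \<comment> \<open>The union in \<open>moran_set\<close> runs over extensional functions, hence
      the restriction.\<close>
    let ?u = "restrict w {1..k}"
    have "?u \<in> (\<Pi>\<^sub>E j\<in>{1..k}. D j)" using words_digit[OF w] by auto
    moreover have "X ?u k = X w k" "Y ?u k = Y w k" by (auto intro!: code_cong)
    then have "(s, t) \<in> moran_comp n m ?u k ` ({0..1} \<times> {0..1})"
      using mem_wcell_iff[where w = ?u and k = k] z[of k k] by (simp only:)
    ultimately show ?thesis by blast
  qed
  then show ?thesis using z unfolding moran_set_def by blast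
qed

lemma words_nonempty: "words \<noteq> {}"
  using some_digit by (auto simp: words_def intro!: exI[of _ "\<lambda>i. SOME v. v \<in> D i"])

lemma E_nonempty: "E \<noteq> {}"
  using words_nonempty ex_point_of_word by blast

lemma bounded_cell: "bounded (cell p q c)"
  by (simp add: cell_def digit_int_def bounded_Times)

lemma bounded_E: "bounded E"
proof (rule bounded_subset[OF bounded_cell[of 0 0 "(0, 0)"]])
  show "E \<subseteq> cell 0 0 (0, 0)" using ex_word_of_point[of _ 0] by auto
qed

lemma bounded_ball_Int_E: "bounded (ball x R \<inter> E)"
  using bounded_E by (auto intro: bounded_subset)

section \<open>Comparison of cells with covering sets\<close>

lemma dist_cell_le:
  assumes "z \<in> cell p q c" "z' \<in> cell p q c"
  shows "dist z z' \<le> 1 / lev n p + 1 / lev m q"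
proof -
  have "dist z z' \<le> \<bar>fst z - fst z'\<bar> + \<bar>snd z - snd z'\<bar>"
    unfolding dist_prod_def dist_real_def by (rule sqrt_sum_squares_le_sum) auto
  also have "\<dots> \<le> 1 / lev n p + 1 / lev m q"
    using assms lev_pos by (intro add_mono digit_int_dist) (auto simp: cell_def mem_Times_iff)
  finally show ?thesis .
qed

lemma cells_near_point:
  assumes "\<rho> * lev n p \<le> 1" "\<rho> * lev m q \<le> 1"
  shows "\<exists>F. finite F \<and> card F \<le> 16 \<and> {c. \<exists>z\<in>cell p q c. dist z x \<le> \<rho>} \<subseteq> F"
proof -
  obtain F where F: "finite F" "card F \<le> 4" "{c. \<exists>t\<in>digit_int n p c. \<bar>t - fst x\<bar> \<le> \<rho>} \<subseteq> F"
    using digit_ints_near_point[OF lev_pos(1) assms(1), of "fst x"] by blast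
  obtain G where G: "finite G" "card G \<le> 4" "{c. \<exists>t\<in>digit_int m q c. \<bar>t - snd x\<bar> \<le> \<rho>} \<subseteq> G"
    using digit_ints_near_point[OF lev_pos(2) assms(2), of "snd x"] by blast
  have "{c. \<exists>z\<in>cell p q c. dist z x \<le> \<rho>} \<subseteq> F \<times> G"
  proof safe
    fix a b s t assume st: "(s, t) \<in> cell p q (a, b)" "dist (s, t) x \<le> \<rho>"
    have "\<bar>s - fst x\<bar> \<le> \<rho>" "\<bar>t - snd x\<bar> \<le> \<rho>"
      using dist_fst_le[of "(s, t)" x] dist_snd_le[of "(s, t)" x] st(2) by (simp_all add: dist_real_def)
    then show "a \<in> F" "b \<in> G" using st(1) F(3) G(3) by (auto simp: cell_def)
  qed
  moreover have "card (F \<times> G) \<le> 16" using mult_le_mono[OF F(2) G(2)] by (simp add: card_cartesian_product)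
  ultimately show ?thesis using finite_cartesian_product[OF F(1) G(1)] by (intro exI[of _ "F \<times> G"] conjI)
qed

text \<open>A set of diameter at most \<open>r\<close> stays within \<open>r\<close> of any of its
  points, so it meets at most 16 = 4 * 4 cells. Summing over an optimal cover gives the
  bound.\<close>

lemma card_cells_le_covering_number:
  assumes "finite C" "bounded A" "r > 0" "r * lev n p \<le> 1" "r * lev m q \<le> 1"
    and "\<And>c. c \<in> C \<Longrightarrow> A \<inter> cell p q c \<noteq> {}"
  shows "card C \<le> 16 * covering_number r A"
proof -
  obtain \<U> where \<U>: "finite \<U>" "card \<U> = covering_number r A" "A \<subseteq> \<Union>\<U>"
    "\<And>U. U \<in> \<U> \<Longrightarrow> bounded U \<and> diameter U \<le> r"
    using covering_number_cover[OF assms(2,3)] by metis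
  define G where "G = (\<lambda>U. {c \<in> C. U \<inter> cell p q c \<noteq> {}})"
  have "card (G U) \<le> 16" if U: "U \<in> \<U>" for U
  proof (cases "U = {}")
    case False
    then obtain x where x: "x \<in> U" by blast
    obtain F where F: "finite F" "card F \<le> 16" "{c. \<exists>z\<in>cell p q c. dist z x \<le> r} \<subseteq> F"
      using cells_near_point[OF assms(4,5), of x] by blast
    have "dist z x \<le> r" if "z \<in> U" for z
      using diameter_bounded_bound[OF _ that x] \<U>(4)[OF U] by force
    then have "G U \<subseteq> F" using F(3) by (auto simp: G_def)
    from card_mono[OF F(1) this] F(2) show ?thesis by linarith
  qed (simp add: G_def)
  then have "(\<Sum>U\<in>\<U>. card (G U)) \<le> (\<Sum>U\<in>\<U>. 16)" by (rule sum_mono)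
  moreover have "C \<subseteq> (\<Union>U\<in>\<U>. G U)"
  proof
    fix c assume "c \<in> C"
    with assms(6) obtain z where "z \<in> A" "z \<in> cell p q c" by blast
    moreover from this(1) \<U>(3) obtain U where "U \<in> \<U>" "z \<in> U" by blast
    ultimately show "c \<in> (\<Union>U\<in>\<U>. G U)" using \<open>c \<in> C\<close> unfolding G_def by blast
  qed
  then have "card C \<le> card (\<Union>U\<in>\<U>. G U)"
    using assms(1) \<U>(1) by (intro card_mono) (auto simp: G_def)
  moreover have "\<dots> \<le> (\<Sum>U\<in>\<U>. card (G U))" by (rule card_UN_le[OF \<U>(1)])
  ultimately show ?thesis using \<U>(2) by simp
qed

lemma covering_number_le_card_cells:
  assumes "finite C" "A \<subseteq> (\<Union>c\<in>C. cell p q c)" "1 / lev n p + 1 / lev m q \<le> r"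
  shows "covering_number r A \<le> card C"
proof -
  have "r \<ge> 0" using assms(3) lev_pos(1)[of p] lev_pos(2)[of q]
    by (meson add_nonneg_nonneg divide_nonneg_pos order_trans zero_le_one)
  have "diameter (cell p q c) \<le> r" for c
    by (rule diameter_le) (use \<open>r \<ge> 0\<close> order_trans[OF dist_cell_le assms(3)] in \<open>simp_all add: dist_norm\<close>)
  then have "covering_number r A \<le> card (cell p q ` C)"
    by (intro covering_number_le) (use assms bounded_cell in auto)
  also have "\<dots> \<le> card C" by (rule card_image_le[OF assms(1)])
  finally show ?thesis .
qed

text \<open>The ball is larger than the diameter of the cell and therefore contains it; each subcell
  contributes a point of \<open>E\<close> inside the ball.\<close>

lemma card_subcells_le_covering_number:
  assumes w: "w \<in> words" and x: "x \<in> wcell w p q" and le: "p \<le> p'" "q \<le> q'"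
    and R: "1 / lev n p + 1 / lev m q < R"
    and r: "r > 0" "r * lev n p' \<le> 1" "r * lev m q' \<le> 1"
  shows "card (subcells p q p' q' w) \<le> 16 * covering_number r (ball x R \<inter> E)"
proof (rule card_cells_le_covering_number[OF card_subcells(1)[OF w le] bounded_ball_Int_E r])
  fix c assume "c \<in> subcells p q p' q' w"
  then obtain v where v: "v \<in> words" "X v p = X w p" "Y v q = Y w q" "c = (X v p', Y v q')"
    by (auto simp: subcells_def)
  obtain z where z: "z \<in> E" "\<And>p q. z \<in> wcell v p q" using ex_point_of_word[OF v(1)] by blast
  have "z \<in> wcell w p q" using z(2)[of p q] v by simp
  from dist_cell_le[OF x this] R have "dist x z < R" by linarith
  then show "ball x R \<inter> E \<inter> cell p' q' c \<noteq> {}" using z v(4) by auto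
qed

text \<open>The centre is a point coded by a separated word. The radius is at most the cell sides
  four levels deeper, so every point of \<open>E\<close> in the ball has codes close to those of the
  centre at offsets 0 to 4, and hence lies in the same cell.\<close>

lemma ex_point_covering_number_le:
  assumes le: "p \<le> p'" "q \<le> q'"
    and \<rho>: "\<And>i. i \<ge> 1 \<Longrightarrow> \<exists>w\<in>D i. row_card (D i) (snd w) = \<rho> i"
    and \<rho>h: "\<And>i. i \<ge> 1 \<Longrightarrow> \<exists>w\<in>D i. col_card (D i) (fst w) = \<rho>h i"
    and R: "R * lev n (p + 4) \<le> 1" "R * lev m (q + 4) \<le> 1"
    and r: "1 / lev n p' + 1 / lev m q' \<le> r"
  shows "\<exists>x\<in>E. covering_number r (ball x R \<inter> E) \<le> cell_count \<rho> \<rho>h D p q p' q'"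
proof -
  obtain w where w: "w \<in> words" "card (subcells p q p' q' w) = cell_count \<rho> \<rho>h D p q p' q'"
    and sep: "\<And>v. v \<in> words \<Longrightarrow>
      (\<forall>j\<le>4. \<bar>int (X v (p+j)) - int (X w (p+j))\<bar> \<le> 1 \<and> \<bar>int (Y v (q+j)) - int (Y w (q+j))\<bar> \<le> 1) \<Longrightarrow>
      X v p = X w p \<and> Y v q = Y w q"
    using separated_word[OF le, of \<rho> \<rho>h, OF \<rho> \<rho>h] by blast
  obtain x where x: "x \<in> E" "\<And>p q. x \<in> wcell w p q" using ex_point_of_word[OF w(1)] by blast
  have "ball x R \<inter> E \<subseteq> (\<Union>c\<in>subcells p q p' q' w. cell p' q' c)"
  proof
    fix z assume z: "z \<in> ball x R \<inter> E"
    let ?K = "max (max (p+4) (q+4)) (max p' q')"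
    obtain v where v: "v \<in> words" "\<And>i j. i \<le> ?K \<Longrightarrow> j \<le> ?K \<Longrightarrow> z \<in> wcell v i j"
      using ex_word_of_point[of z ?K] z by blast
    have "\<bar>int (X v (p+j)) - int (X w (p+j))\<bar> \<le> 1 \<and> \<bar>int (Y v (q+j)) - int (Y w (q+j))\<bar> \<le> 1"
      if j: "j \<le> 4" for j
    proof -
      have "dist z x < R" using z by (simp add: dist_commute)
      moreover have "lev n (p + j) \<le> lev n (p + 4)" "lev m (q + j) \<le> lev m (q + 4)"
        using n_bounds m_bounds j by (auto intro!: lev_mono)
      moreover have "R \<le> 1 / lev n (p + 4)" "R \<le> 1 / lev m (q + 4)"
        using R lev_pos by (simp_all add: field_simps)
      moreover have "1 / lev n (p + 4) \<le> 1 / lev n (p + j)" "1 / lev m (q + 4) \<le> 1 / lev m (q + j)"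
        using calculation(2,3) lev_pos by (auto intro!: divide_left_mono)
      ultimately have d: "\<bar>fst z - fst x\<bar> < 1 / lev n (p + j)" "\<bar>snd z - snd x\<bar> < 1 / lev m (q + j)"
        using dist_fst_le[of z x] dist_snd_le[of z x] unfolding dist_real_def by linarith+
      have c: "z \<in> wcell v (p + j) (q + j)" "x \<in> wcell w (p + j) (q + j)"
        using v(2)[of "p + j" "q + j"] x(2) j by auto
      show ?thesis
        using close_digit_ints[OF lev_pos(1) _ _ d(1)] close_digit_ints[OF lev_pos(2) _ _ d(2)] c
        unfolding cell_def mem_Times_iff fst_conv snd_conv by blast
    qed
    then have "X v p = X w p \<and> Y v q = Y w q" using sep[OF v(1)] by blast
    then have "(X v p', Y v q') \<in> subcells p q p' q' w" using v(1) by (auto simp: subcells_def)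
    moreover have "z \<in> wcell v p' q'" using v(2) by simp
    ultimately show "z \<in> (\<Union>c\<in>subcells p q p' q' w. cell p' q' c)" by blast
  qed
  from covering_number_le_card_cells[OF card_subcells(1)[OF w(1) le] this r] show ?thesis
    using x(1) w(2) by auto
qed

text \<open>The ball meets at most 16 cells, and the maximal fibres bound the subcells of each, so
  the centre is arbitrary.\<close>

lemma covering_number_le_cell_count:
  assumes le: "p \<le> p'" "q \<le> q'"
    and R: "R * lev n p \<le> 1" "R * lev m q \<le> 1"
    and r: "1 / lev n p' + 1 / lev m q' \<le> r"
  shows "covering_number r (ball x R \<inter> E) \<le>
    16 * cell_count (\<lambda>i. row_max (m i) (D i)) (\<lambda>i. col_max (n i) (D i)) D p q p' q'" (is "_ \<le> 16 * ?N")
proof -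
  obtain F where F: "finite F" "card F \<le> 16" "{c. \<exists>z\<in>cell p q c. dist z x \<le> R} \<subseteq> F"
    using cells_near_point[OF R, of x] by blast
  \<comment> \<open>Only codes realised by words count; one representing word is chosen for
    each.\<close>
  let ?F = "{c \<in> F. \<exists>v\<in>words. c = (X v p, Y v q)}"
  have "\<forall>c\<in>?F. \<exists>v. v \<in> words \<and> c = (X v p, Y v q)" by blast
  from bchoice[OF this] obtain w where w: "\<And>c. c \<in> ?F \<Longrightarrow> w c \<in> words \<and> c = (X (w c) p, Y (w c) q)"
    by blast
  let ?C = "\<Union>c\<in>?F. subcells p q p' q' (w c)"
  have fin: "finite ?F" using F(1) by simp
  have "ball x R \<inter> E \<subseteq> (\<Union>c\<in>?C. cell p' q' c)"
  proof
    fix z assume z: "z \<in> ball x R \<inter> E"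
    let ?K = "max (max p q) (max p' q')"
    obtain v where v: "v \<in> words" "\<And>i j. i \<le> ?K \<Longrightarrow> j \<le> ?K \<Longrightarrow> z \<in> wcell v i j"
      using ex_word_of_point[of z ?K] z by blast
    let ?c = "(X v p, Y v q)"
    have "z \<in> wcell v p q" "z \<in> wcell v p' q'" using v(2) by simp_all
    then have c: "?c \<in> ?F" using F(3) z v(1) by (force simp: dist_commute)
    then have "(X v p', Y v q') \<in> subcells p q p' q' (w ?c)" using w[OF c] v(1) by (force simp: subcells_def)
    then show "z \<in> (\<Union>c\<in>?C. cell p' q' c)" using c \<open>z \<in> wcell v p' q'\<close> by blast
  qed
  then have "covering_number r (ball x R \<inter> E) \<le> card ?C"
    by (rule covering_number_le_card_cells[OF _ _ r, rotated]) (use fin w card_subcells(1)[OF _ le] in blast)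
  also have "\<dots> \<le> (\<Sum>c\<in>?F. card (subcells p q p' q' (w c)))" by (rule card_UN_le[OF fin])
  also have "\<dots> \<le> (\<Sum>c\<in>?F. ?N)" by (rule sum_mono) (use w card_subcells_le[OF _ le] in blast)
  also have "\<dots> = card ?F * ?N" by simp
  also have "\<dots> \<le> 16 * ?N" using card_mono[OF F(1), of ?F] F(2) by (intro mult_le_mono1) auto
  finally show ?thesis .
qed


section \<open>Approximate squares\<close>

abbreviation l :: "nat \<Rightarrow> nat" where "l \<equiv> moran_l n m"
abbreviation M :: "nat \<Rightarrow> real" where "M \<equiv> lev m"

lemma L_ge_2: "L \<ge> 2"
  using n_bounds[of 1] by simp

lemma M_mono: "k \<le> k' \<Longrightarrow> M k \<le> M k'"
  using m_bounds by (auto intro: lev_mono)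

lemma M_unbounded: "\<exists>k. t < M k"
proof -
  obtain k where "t < 2 ^ k" using real_arch_pow[of 2 t] by auto
  moreover have "2 ^ (k - 0) * M 0 \<le> M k" using m_bounds by (intro lev_growth) auto
  ultimately show ?thesis by (intro exI[of _ k]) simp
qed

lemma M_Suc_le: "M (Suc k) \<le> real L * M k"
  using m_bounds[of "Suc k"] lev_pos(2)[of k] by (simp add: lev_Suc mult.commute mult_right_mono)

text \<open>Justifies the \<open>THE\<close>: the least \<open>j\<close> with
  \<open>M k \<le> lev n j\<close> has the defining property, and monotonicity of
  \<open>lev n\<close> makes it unique.\<close>

lemma moran_l_props:
  assumes k: "k \<ge> 1"
  shows "l k \<ge> 1" "M k \<le> lev n (l k)" "lev n (l k - 1) < M k"
proof -
  let ?P = "\<lambda>j. j \<ge> 1 \<and> M k \<le> lev n j \<and> lev n (j - 1) < M k"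
  have iff: "1 / lev n i \<le> 1 / M k \<longleftrightarrow> M k \<le> lev n i" "1 / M k < 1 / lev n i \<longleftrightarrow> lev n i < M k" for i
    using lev_pos(1)[of i] lev_pos(2)[of k] by (simp_all add: field_simps)
  have l: "l k = (THE j. ?P j)"
    unfolding moran_l_def lev_def[symmetric] iff ..
  have "2 ^ (k - 0) * M 0 \<le> M k" using m_bounds by (intro lev_growth) auto
  moreover have "(1::real) < 2 ^ k" using k by (intro one_less_power) auto
  ultimately have M1: "1 < M k" by simp
  obtain i where "M k < 2 ^ i" using real_arch_pow[of 2 "M k"] by auto
  moreover have "2 ^ (i - 0) * lev n 0 \<le> lev n i" using n_bounds by (intro lev_growth) auto
  ultimately have "M k \<le> lev n i" by simp
  define j where "j = (LEAST j. M k \<le> lev n j)"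
  have j: "M k \<le> lev n j" unfolding j_def by (rule LeastI[of "\<lambda>j. M k \<le> lev n j"]) fact
  \<comment> \<open>Because \<open>M k > 1 = lev n 0\<close>; hence \<open>j - 1\<close> is a true
    predecessor.\<close>
  have j1: "j \<ge> 1" using j M1 by (cases j) auto
  then have "\<not> M k \<le> lev n (j - 1)" unfolding j_def by (intro not_less_Least) auto
  then have P: "?P j" using j j1 by simp
  have "i = j" if "?P i" for i
  proof (rule ccontr)
    assume "i \<noteq> j"
    then have "i \<le> j - 1 \<or> j \<le> i - 1" by auto
    then have "lev n i \<le> lev n (j - 1) \<or> lev n j \<le> lev n (i - 1)"
      using n_bounds by (auto intro: lev_mono)
    then show False using that P by linarith
  qed
  with P have "?P (l k)" unfolding l by (rule theI)
  then show "l k \<ge> 1" "M k \<le> lev n (l k)" "lev n (l k - 1) < M k" by auto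
qed

text \<open>Here bounded bases make the cells nearly square: together with
  \<open>moran_l_props\<close> the width lies between \<open>1 / (L * M k)\<close> and
  \<open>1 / M k\<close>.\<close>

lemma lev_l_le:
  assumes "k \<ge> 1"
  shows "lev n (l k) \<le> real L * M k"
proof -
  have "lev n (l k) = real (n (l k)) * lev n (l k - 1)"
    using lev_Suc[of n "l k - 1"] moran_l_props(1)[OF assms] by (simp add: mult.commute)
  also have "\<dots> \<le> real L * M k"
    using moran_l_props[OF assms] n_bounds[of "l k"] lev_pos(1)[of "l k - 1"] by (intro mult_mono) auto
  finally show ?thesis .
qed

lemma moran_l_mono:
  assumes "1 \<le> k" "k \<le> k'"
  shows "l k \<le> l k'"
proof (rule ccontr)
  assume "\<not> l k \<le> l k'"
  then have "l k' \<le> l k - 1" by simp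
  then have "lev n (l k') \<le> lev n (l k - 1)" using n_bounds by (intro lev_mono) auto
  then show False
    using moran_l_props(3)[OF assms(1)] moran_l_props(2)[of k'] M_mono[OF assms(2)] assms by simp
qed

text \<open>Equals 1 at \<open>k = k'\<close>, a convenient base value outside the range
  \<open>k < k'\<close> of the original formula.\<close>

definition Nm :: "nat \<Rightarrow> nat \<Rightarrow> nat" where
  "Nm k k' = cell_count (\<lambda>i. row_min (D i)) (\<lambda>i. col_min (D i)) D (l k) k (l k') k'"

definition Np :: "nat \<Rightarrow> nat \<Rightarrow> nat" where
  "Np k k' = cell_count (\<lambda>i. row_max (m i) (D i)) (\<lambda>i. col_max (n i) (D i)) D (l k) k (l k') k'"

lemma Nm_eq: "1 \<le> k \<Longrightarrow> k < k' \<Longrightarrow> moran_N_minus n m D k k' = Nm k k'"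
  by (simp add: moran_N_minus_def Nm_def moran_N_aux_eq_cell_count moran_l_mono)

lemma Np_eq: "1 \<le> k \<Longrightarrow> k < k' \<Longrightarrow> moran_N_plus n m D k k' = Np k k'"
  by (simp add: moran_N_plus_def Np_def moran_N_aux_eq_cell_count moran_l_mono)

lemma Nm_supermult:
  assumes "1 \<le> k" "k \<le> k'" "k' \<le> k''"
  shows "Nm k k' * Nm k' k'' \<le> Nm k k''"
  unfolding Nm_def
  by (rule cell_count_supermult)
    (use assms in \<open>auto intro!: row_min_mult_row_num_le col_min_mult_col_num_le moran_l_mono simp: finite_digits\<close>)

lemma Np_submult:
  assumes "1 \<le> k" "k \<le> k'" "k' \<le> k''"
  shows "Np k k'' \<le> Np k k' * Np k' k''"
  unfolding Np_def
  by (rule cell_count_submult)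
    (use assms in \<open>auto intro!: card_le_row_max_mult_row_num[OF digits_subset]
      card_le_col_max_mult_col_num[OF digits_subset] moran_l_mono\<close>)

lemmas min_attained = row_min_attained[OF finite_digits digits_nonempty]
  col_min_attained[OF finite_digits digits_nonempty]
lemmas max_attained = row_max_attained[OF digits_subset digits_nonempty]
  col_max_attained[OF digits_subset digits_nonempty]

text \<open>The count is the size of an actual nonempty set of subcells, hence at least 1. The full
  grid bounds it by an area ratio, with one factor \<open>L\<close> for the deviation from
  squares.\<close>

lemma count_bounds:
  assumes k: "1 \<le> k" "k \<le> k'"
    and \<rho>: "\<And>i. i \<ge> 1 \<Longrightarrow> \<exists>w\<in>D i. row_card (D i) (snd w) = \<rho> i"
    and \<rho>h: "\<And>i. i \<ge> 1 \<Longrightarrow> \<exists>w\<in>D i. col_card (D i) (fst w) = \<rho>h i"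
  shows "1 \<le> cell_count \<rho> \<rho>h D (l k) k (l k') k'"
    and "real (cell_count \<rho> \<rho>h D (l k) k (l k') k') \<le> real L * (M k' / M k)\<^sup>2"
proof -
  let ?N = "cell_count \<rho> \<rho>h D (l k) k (l k') k'"
  obtain w where w: "w \<in> words" "card (subcells (l k) k (l k') k' w) = ?N"
    using separated_word[OF moran_l_mono[OF k] k(2), of \<rho> \<rho>h, OF \<rho> \<rho>h] by blast
  have "subcells (l k) k (l k') k' w \<noteq> {}" using w(1) by (auto simp: subcells_def)
  then show "1 \<le> ?N"
    using w card_subcells(1)[OF w(1) moran_l_mono[OF k] k(2)] by (metis One_nat_def Suc_leI card_gt_0_iff)
  have "\<rho> i \<le> n i" "\<rho>h i \<le> m i" if i: "i \<ge> 1" for i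
  proof -
    have "{a. (a, j) \<in> D i} \<subseteq> {..<n i}" "{b. (j, b) \<in> D i} \<subseteq> {..<m i}" for j
      using digit_less[OF _ i] by force+
    from card_mono[OF _ this(1)] card_mono[OF _ this(2)]
    have "row_card (D i) j \<le> n i" "col_card (D i) j \<le> m i" for j
      by (simp_all add: row_card_def col_card_def)
    then show "\<rho> i \<le> n i" "\<rho>h i \<le> m i" using \<rho>[OF i] \<rho>h[OF i] by metis+
  qed
  from cell_count_le[OF moran_l_mono[OF k] k(2) this]
  have "real ?N * (lev n (l k) * M k) \<le> lev n (l k') * M k'" .
  moreover have "real ?N * (M k * M k) \<le> real ?N * (lev n (l k) * M k)"
    using moran_l_props(2)[OF k(1)] lev_pos(2)[of k] by (intro mult_left_mono mult_right_mono) auto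
  moreover have "lev n (l k') * M k' \<le> (real L * M k') * M k'"
    using lev_l_le[of k'] k lev_pos(2)[of k'] by (intro mult_right_mono) auto
  ultimately have "real ?N * (M k * M k) \<le> real L * (M k' * M k')" by simp
  then show "real ?N \<le> real L * (M k' / M k)\<^sup>2"
    using lev_pos(2)[of k] by (simp add: power2_eq_square field_simps)
qed

lemma Nm_bounds:
  assumes "1 \<le> k" "k \<le> k'"
  shows "1 \<le> Nm k k'" "real (Nm k k') \<le> real L * (M k' / M k)\<^sup>2"
  unfolding Nm_def using count_bounds[OF assms min_attained] by blast+

lemma Np_bounds:
  assumes "1 \<le> k" "k \<le> k'"
  shows "1 \<le> Np k k'" "real (Np k k') \<le> real L * (M k' / M k)\<^sup>2"
  unfolding Np_def using count_bounds[OF assms max_attained] by blast+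

lemma cell_sides_le:
  assumes "1 \<le> k"
  shows "1 / lev n (l k) + 1 / M k \<le> 2 / M k"
proof -
  have "1 / lev n (l k) \<le> 1 / M k"
    using moran_l_props(2)[OF assms] lev_pos(2)[of k] lev_pos(1)[of "l k"] by (intro divide_left_mono) auto
  then show ?thesis by simp
qed

lemma scale_le:
  assumes "1 \<le> k" "0 < r" "r * real L * M k \<le> 1"
  shows "r * lev n (l k) \<le> 1" "r * M k \<le> 1"
proof -
  have "r * lev n (l k) \<le> r * (real L * M k)"
    using lev_l_le[OF assms(1)] assms(2) by (intro mult_left_mono) auto
  then show "r * lev n (l k) \<le> 1" using assms(3) by (simp add: mult.assoc)
  have "1 * M k \<le> real L * M k" using L_ge_2 lev_pos(2)[of k] by (intro mult_right_mono) auto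
  then have "r * M k \<le> r * (real L * M k)" using assms(2) by (intro mult_left_mono) auto
  then show "r * M k \<le> 1" using assms(3) by (simp add: mult.assoc)
qed

section \<open>Square counts as covering numbers\<close>

lemma Nm_le_covering_number:
  assumes x: "x \<in> E" and k: "1 \<le> k" "k \<le> k'" and R: "2 / M k < R"
    and r: "0 < r" "r * real L * M k' \<le> 1"
  shows "Nm k k' \<le> 16 * covering_number r (ball x R \<inter> E)"
proof -
  obtain w where w: "w \<in> words" "x \<in> wcell w (l k) k"
    using ex_word_of_point[OF x, of "max (l k) k"] by auto
  have "Nm k k' \<le> card (subcells (l k) k (l k') k' w)"
    unfolding Nm_def by (rule card_subcells_ge[OF w(1) moran_l_mono[OF k] k(2)])
  also have "\<dots> \<le> 16 * covering_number r (ball x R \<inter> E)"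
    using cell_sides_le[OF k(1)] R scale_le[of k' r] k r
    by (intro card_subcells_le_covering_number[OF w moran_l_mono[OF k] k(2)]) auto
  finally show ?thesis .
qed

lemma ex_Np_le_covering_number:
  assumes k: "1 \<le> k" "k \<le> k'" and R: "2 / M k < R" and r: "0 < r" "r * real L * M k' \<le> 1"
  shows "\<exists>x\<in>E. Np k k' \<le> 16 * covering_number r (ball x R \<inter> E)"
proof -
  obtain w where w: "w \<in> words" "card (subcells (l k) k (l k') k' w) = Np k k'"
    using separated_word[OF moran_l_mono[OF k] k(2) max_attained] unfolding Np_def by blast
  obtain x where x: "x \<in> E" "x \<in> wcell w (l k) k" using ex_point_of_word[OF w(1)] by blast
  have "card (subcells (l k) k (l k') k' w) \<le> 16 * covering_number r (ball x R \<inter> E)"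
    using cell_sides_le[OF k(1)] R scale_le[of k' r] k r
    by (intro card_subcells_le_covering_number[OF w(1) x(2) moran_l_mono[OF k] k(2)]) auto
  then show ?thesis using x(1) w(2) by auto
qed

text \<open>Of the power \<open>L ^ 5\<close>, four factors pay for the separation depth 4 and one
  for the cells not being exact squares.\<close>

lemma ex_covering_number_le_Nm:
  assumes k: "1 \<le> k" "k \<le> k'" and R: "0 < R" "R * real L ^ 5 * M k \<le> 1" and r: "2 / M k' \<le> r"
  shows "\<exists>x\<in>E. covering_number r (ball x R \<inter> E) \<le> Nm k k'"
  unfolding Nm_def
proof (rule ex_point_covering_number_le[OF moran_l_mono[OF k] k(2) min_attained])
  have L: "1 \<le> real L" "0 < M k" using L_ge_2 lev_pos by auto
  have "lev n (l k + 4) \<le> lev n (l k) * real L ^ 4"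
    using lev_le_power[of n L "l k" "l k + 4"] n_bounds by simp
  also have "\<dots> \<le> (real L * M k) * real L ^ 4" by (intro mult_right_mono lev_l_le k) auto
  finally have "lev n (l k + 4) \<le> real L ^ 5 * M k" by (simp add: eval_nat_numeral mult_ac)
  then have "R * lev n (l k + 4) \<le> R * (real L ^ 5 * M k)" using R(1) by (intro mult_left_mono) auto
  then show "R * lev n (l k + 4) \<le> 1" using R(2) by (simp add: mult.assoc)
  have "M (k + 4) \<le> M k * real L ^ 4"
    using lev_le_power[of m L k "k + 4"] m_bounds by simp
  also have "\<dots> \<le> M k * real L ^ 5"
    using L by (intro mult_left_mono power_increasing) auto
  finally have "M (k + 4) \<le> real L ^ 5 * M k" by (simp add: mult.commute)
  then have "R * M (k + 4) \<le> R * (real L ^ 5 * M k)" using R(1) by (intro mult_left_mono) auto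
  then show "R * M (k + 4) \<le> 1" using R(2) by (simp add: mult.assoc)
  show "1 / lev n (l k') + 1 / M k' \<le> r" using cell_sides_le[of k'] k r by simp
qed auto

lemma covering_number_le_Np:
  assumes k: "1 \<le> k" "k \<le> k'" and R: "0 < R" "R * real L * M k \<le> 1" and r: "2 / M k' \<le> r"
  shows "covering_number r (ball x R \<inter> E) \<le> 16 * Np k k'"
  unfolding Np_def
  by (rule covering_number_le_cell_count[OF moran_l_mono[OF k] k(2)])
    (use scale_le[OF k(1) R] cell_sides_le[of k'] k r in auto)


section \<open>The dimensions in terms of cell counts\<close>

definition gm :: "nat \<Rightarrow> nat \<Rightarrow> real" where "gm k p = ln (real (Nm k (k + p)))"
definition gp :: "nat \<Rightarrow> nat \<Rightarrow> real" where "gp k p = ln (real (Np k (k + p)))"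
definition h :: "nat \<Rightarrow> nat \<Rightarrow> real" where "h k p = ln (M (k + p) / M k)"

lemma h_eq_prod: "h k p = ln (\<Prod>i=k+1..k+p. real (m i))"
  using lev_split[of k "k + p" m] lev_pos(2)[of k] by (simp add: h_def)

lemma h_add: "h k (p + q) = h k p + h (k + p) q"
proof -
  have "M j \<noteq> 0" for j using lev_pos(2)[of j] by simp
  then show ?thesis using lev_pos(2) by (simp add: h_def ln_div add.assoc)
qed

lemma h_ge: "real p * ln 2 \<le> h k p"
proof -
  have "2 ^ (k + p - k) * M k \<le> M (k + p)" using m_bounds by (intro lev_growth) auto
  then have "2 ^ p \<le> M (k + p) / M k" using lev_pos(2)[of k] by (simp add: field_simps)
  then have "ln (2 ^ p) \<le> h k p" using lev_pos(2) unfolding h_def by (subst ln_le_cancel_iff) auto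
  then show ?thesis by (simp add: ln_realpow)
qed

lemma h_nonneg: "0 \<le> h k p"
  using h_ge[of p k] by (rule order_trans[rotated]) simp

lemma h_le: "h k p \<le> real p * ln (real L)"
proof -
  have "M (k + p) \<le> M k * real L ^ p" using lev_le_power[of m L k "k + p"] m_bounds by simp
  then have "M (k + p) / M k \<le> real L ^ p" using lev_pos(2)[of k] by (simp add: field_simps)
  then have "h k p \<le> ln (real L ^ p)" using lev_pos(2) L_ge_2 unfolding h_def by (subst ln_le_cancel_iff) auto
  then show ?thesis using L_ge_2 by (simp add: ln_realpow)
qed

lemma h_le_of_ge: "k \<le> k0 \<Longrightarrow> k0 \<le> k + p \<Longrightarrow> h k0 (k + p - k0) \<le> h k p"
  using h_add[of k "k0 - k" "k + p - k0"] h_nonneg[of k "k0 - k"] by simp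

lemma gm_bounds: "k \<ge> 1 \<Longrightarrow> 0 \<le> gm k p" "k \<ge> 1 \<Longrightarrow> gm k p \<le> ln (real L) + 2 * h k p"
proof -
  assume k: "k \<ge> 1"
  note N = Nm_bounds[OF k le_add1[of k p]]
  show "0 \<le> gm k p" unfolding gm_def using N(1) by simp
  have "gm k p \<le> ln (real L * (M (k + p) / M k)\<^sup>2)"
    unfolding gm_def using N lev_pos(2) L_ge_2 by (subst ln_le_cancel_iff) auto
  also have "\<dots> = ln (real L) + 2 * h k p"
    using lev_pos(2)[of k] lev_pos(2)[of "k + p"] L_ge_2 by (simp add: ln_mult ln_realpow h_def)
  finally show "gm k p \<le> ln (real L) + 2 * h k p" .
qed

lemma gp_bounds: "k \<ge> 1 \<Longrightarrow> 0 \<le> gp k p" "k \<ge> 1 \<Longrightarrow> gp k p \<le> ln (real L) + 2 * h k p"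
proof -
  assume k: "k \<ge> 1"
  note N = Np_bounds[OF k le_add1[of k p]]
  show "0 \<le> gp k p" unfolding gp_def using N(1) by simp
  have "gp k p \<le> ln (real L * (M (k + p) / M k)\<^sup>2)"
    unfolding gp_def using N lev_pos(2) L_ge_2 by (subst ln_le_cancel_iff) auto
  also have "\<dots> = ln (real L) + 2 * h k p"
    using lev_pos(2)[of k] lev_pos(2)[of "k + p"] L_ge_2 by (simp add: ln_mult ln_realpow h_def)
  finally show "gp k p \<le> ln (real L) + 2 * h k p" .
qed

lemma gm_superadditive:
  assumes "k \<ge> 1"
  shows "gm k p + gm (k + p) q \<le> gm k (p + q)"
proof -
  have N: "1 \<le> Nm k (k + p)" "1 \<le> Nm (k + p) (k + p + q)" "1 \<le> Nm k (k + (p + q))"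
    using assms by (simp_all only: Nm_bounds le_add1 trans_le_add1)
  then have "gm k p + gm (k + p) q = ln (real (Nm k (k + p) * Nm (k + p) (k + p + q)))"
    by (simp add: gm_def ln_mult)
  also have "\<dots> \<le> gm k (p + q)"
    unfolding gm_def using Nm_supermult[of k "k + p" "k + p + q"] N assms
    by (subst ln_le_cancel_iff) (auto simp: add.assoc simp flip: of_nat_mult)
  finally show ?thesis .
qed

lemma gp_subadditive:
  assumes "k \<ge> 1"
  shows "gp k (p + q) \<le> gp k p + gp (k + p) q"
proof -
  have N: "1 \<le> Np k (k + p)" "1 \<le> Np (k + p) (k + p + q)" "1 \<le> Np k (k + (p + q))"
    using assms by (simp_all only: Np_bounds le_add1 trans_le_add1)
  have "gp k (p + q) \<le> ln (real (Np k (k + p) * Np (k + p) (k + p + q)))"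
    unfolding gp_def using Np_submult[of k "k + p" "k + p + q"] N assms
    by (subst ln_le_cancel_iff) (auto simp: add.assoc simp flip: of_nat_mult)
  also have "\<dots> = gp k p + gp (k + p) q" using N by (simp add: gp_def ln_mult)
  finally show ?thesis .
qed

text \<open>Copied verbatim from \<open>lower_dimension\<close>, so that the dimension folds to
  \<open>Sup lower_exps\<close>; likewise for \<open>assouad_exps\<close>.\<close>

definition lower_exps :: "real set" where
  "lower_exps = {\<alpha>. \<alpha> \<ge> 0 \<and> (\<exists>b>0. \<exists>c>0. \<forall>r R. 0 < r \<and> r < R \<and> R < b \<longrightarrow>
     (INF x\<in>E. real (covering_number r (ball x R \<inter> E))) \<ge> c * (R / r) powr \<alpha>)}"

definition assouad_exps :: "real set" where
  "assouad_exps = {\<alpha>. \<alpha> \<ge> 0 \<and> (\<exists>b>0. \<exists>c>0. \<forall>r R. 0 < r \<and> r < R \<and> R < b \<longrightarrow>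
     (SUP x\<in>E. real (covering_number r (ball x R \<inter> E))) \<le> c * (R / r) powr \<alpha>)}"

section \<open>Admissible exponents and logarithmic count bounds\<close>

lemma ln_const_powr: "0 < c \<Longrightarrow> 0 < t \<Longrightarrow> ln (c * t powr \<alpha>) = ln c + \<alpha> * ln t"
  for c t :: real
  by (simp add: ln_mult ln_powr)

text \<open>A bound uniform in the centre, which makes the supremum over centres a supremum of a
  bounded set.\<close>

lemma covering_number_le_E:
  assumes "r > 0"
  shows "covering_number r (ball x R \<inter> E) \<le> covering_number r E"
  using assms by (intro covering_number_mono bounded_E) auto

text \<open>The exponent is tested on balls covered by \<open>Nm k (k + p)\<close> sets. The
  condition \<open>R < b\<close> requires \<open>k \<ge> k0\<close>; smaller starting levels cost
  only a constant, since \<open>h\<close> is bounded on blocks of length at most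
  \<open>k0\<close>.\<close>

lemma lower_expsD:
  assumes "\<alpha> \<in> lower_exps"
  shows "\<exists>c. \<forall>k\<ge>1. \<forall>p. \<alpha> * h k p - c \<le> gm k p"
proof -
  obtain b c0 where \<alpha>: "\<alpha> \<ge> 0" and b: "b > 0" "c0 > 0"
    and low: "\<And>r R. 0 < r \<Longrightarrow> r < R \<Longrightarrow> R < b \<Longrightarrow>
      c0 * (R / r) powr \<alpha> \<le> (INF x\<in>E. real (covering_number r (ball x R \<inter> E)))"
    using assms unfolding lower_exps_def by blast
  define Q where "Q = 2 * real L ^ 5"
  have "1 * 1 \<le> 2 * real L ^ 5" using L_ge_2 by (intro mult_mono one_le_power) auto
  then have Q: "Q \<ge> 1" by (simp add: Q_def)
  obtain k1 where k1: "2 / (b * Q) < M k1" using M_unbounded by blast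
  define k0 where "k0 = max 1 k1"
  define c1 where "c1 = \<bar>ln c0\<bar> + \<alpha> * ln Q"
  have large: "\<alpha> * h k p - c1 \<le> gm k p" if k: "k \<ge> k0" for k p
  proof -
    have k1': "1 \<le> k" using k by (simp add: k0_def)
    \<comment> \<open>With this \<open>Q\<close>, \<open>R * L ^ 5 * M k = 1\<close>, the largest
      radius that the isolated ball permits.\<close>
    define R where "R = 2 / (Q * M k)"
    define r where "r = 2 / M (k + p)"
    have pos: "R > 0" "r > 0" "M k > 0" "M (k + p) > 0" using Q lev_pos(2) by (auto simp: R_def r_def)
    have "M k1 \<le> M k" using k by (intro M_mono) (simp add: k0_def)
    with k1 have "2 / (b * Q) < M k" by simp
    then have Rb: "R < b" using b Q pos by (simp add: R_def field_simps)
    have Rr: "R / r = M (k + p) / M k / Q" by (simp add: R_def r_def)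
    have lnRr: "ln (R / r) = h k p - ln Q" unfolding Rr h_def using pos Q by (simp add: ln_div ln_mult)
    show ?thesis
    proof (cases "r < R")
      case True
      have "R * real L ^ 5 * M k \<le> 1" using pos L_ge_2 by (simp add: R_def Q_def)
      then obtain x where x: "x \<in> E" "covering_number r (ball x R \<inter> E) \<le> Nm k (k + p)"
        using ex_covering_number_le_Nm[OF k1' le_add1[of k p] pos(1), of r] unfolding r_def by blast
      have "c0 * (R / r) powr \<alpha> \<le> (INF x\<in>E. real (covering_number r (ball x R \<inter> E)))"
        using low[OF pos(2) True Rb] .
      also have "\<dots> \<le> real (covering_number r (ball x R \<inter> E))"
        by (rule cINF_lower[OF _ x(1)]) (auto intro!: bdd_belowI2[of _ 0])
      also have "\<dots> \<le> real (Nm k (k + p))" using x(2) by simp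
      finally have "ln (c0 * (R / r) powr \<alpha>) \<le> gm k p"
        unfolding gm_def using b pos Nm_bounds(1)[OF k1' le_add1[of k p]] by (subst ln_le_cancel_iff) auto
      then have "ln c0 + \<alpha> * (h k p - ln Q) \<le> gm k p"
        using b pos by (subst (asm) ln_const_powr) (auto simp: lnRr)
      then show ?thesis by (simp add: c1_def right_diff_distrib)
    next
      case False
      \<comment> \<open>If the scales are in the wrong order, \<open>h k p \<le> ln Q\<close> and
        the claim is trivial.\<close>
      then have "ln (R / r) \<le> 0" using pos by simp
      then have "\<alpha> * (h k p - ln Q) \<le> 0" using \<alpha> by (simp add: lnRr mult_nonneg_nonpos)
      then show ?thesis using gm_bounds(1)[OF k1', of p] by (simp add: c1_def right_diff_distrib)
    qed
  qed
  define c where "c = c1 + \<alpha> * (real k0 * ln (real L))"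
  have c1: "c1 \<ge> 0" using \<alpha> Q by (simp add: c1_def)
  have hk: "h k j \<le> real k0 * ln (real L)" if "j \<le> k0" for k j
    using h_le[of k j] that L_ge_2 by (meson mult_right_mono of_nat_le_iff ln_ge_zero order_trans of_nat_mono one_le_numeral numeral_le_real_of_nat_iff)
  have "\<alpha> * h k p - c \<le> gm k p" if k: "k \<ge> 1" for k p
  proof -
    consider "k \<ge> k0" | "k \<le> k0" "k0 \<le> k + p" | "k + p \<le> k0" by linarith
    then show ?thesis
    proof cases
      case 1
      have "0 \<le> \<alpha> * (real k0 * ln (real L))" using \<alpha> L_ge_2 by simp
      then show ?thesis using large[OF 1, of p] by (simp add: c_def)
    next
      case 2
      \<comment> \<open>The block is cut at \<open>k0\<close>; superadditivity and
        \<open>gm k ?j \<ge> 0\<close> allow the initial piece of \<open>gm\<close> to be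
        dropped.\<close>
      let ?j = "k0 - k" and ?q = "k + p - k0"
      have e: "k + ?j = k0" "?j + ?q = p" using 2 by auto
      have "\<alpha> * h k p = \<alpha> * h k ?j + \<alpha> * h k0 ?q"
        using h_add[of k ?j ?q] unfolding e by (simp add: distrib_left)
      also have "\<dots> \<le> \<alpha> * (real k0 * ln (real L)) + (gm k0 ?q + c1)"
        using mult_left_mono[OF hk[of ?j k] \<alpha>] large[of k0 ?q] by simp
      also have "gm k0 ?q \<le> gm k p"
        using gm_superadditive[OF k, of ?j ?q] gm_bounds(1)[OF k, of ?j] unfolding e by simp
      finally show ?thesis by (simp add: c_def)
    next
      case 3
      then show ?thesis
        using mult_left_mono[OF hk[of p k] \<alpha>] gm_bounds(1)[OF k, of p] c1 by (simp add: c_def)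
    qed
  qed
  then show ?thesis by blast
qed

lemma ex_scale: "1 \<le> t \<Longrightarrow> \<exists>k. M k \<le> t \<and> t < M (Suc k)"
proof -
  assume t: "1 \<le> t"
  define j where "j = (LEAST j. t < M j)"
  have j: "t < M j" unfolding j_def using M_unbounded by (rule LeastI_ex)
  then have "j \<noteq> 0" using t by (metis lev_0 not_le)
  then have "\<not> t < M (j - 1)" unfolding j_def by (intro not_less_Least) auto
  then show ?thesis using j \<open>j \<noteq> 0\<close> by (intro exI[of _ "j - 1"]) auto
qed

text \<open>Given scales are rounded to levels \<open>?k\<close> and \<open>k'\<close> with
  \<open>M ?k\<close> near \<open>2 / R\<close> and \<open>M k'\<close> near
  \<open>1 / (r * L)\<close>. In \<open>Q = 2 * L ^ 3\<close> the 2 comes from the diameter of a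
  square, two factors \<open>L\<close> from rounding and one from the inequality of its sides.
  Scales with \<open>R \<le> r * Q\<close> are handled by covering numbers being at least 1, hence
  the \<open>min 1\<close> in \<open>c'\<close>.\<close>

lemma lower_expsI:
  assumes \<alpha>: "\<alpha> \<ge> 0" and c: "\<And>k p. k \<ge> 1 \<Longrightarrow> \<alpha> * h k p - c \<le> gm k p"
  shows "\<alpha> \<in> lower_exps"
proof -
  define Q where "Q = 2 * real L ^ 3"
  define c' where "c' = min 1 (exp (- c) / 16) * (1 / Q) powr \<alpha>"
  have L: "1 \<le> real L" using L_ge_2 by simp
  have "1 * 1 \<le> 2 * real L ^ 3" using L by (intro mult_mono one_le_power) auto
  then have Q: "Q \<ge> 1" by (simp add: Q_def)
  have c': "c' > 0" using Q by (simp add: c'_def)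
  have "c' * (R / r) powr \<alpha> \<le> real (covering_number r (ball x R \<inter> E))"
    if r: "0 < r" "r < R" "R < 1" and x: "x \<in> E" for r R x
  proof -
    have eq: "c' * (R / r) powr \<alpha> = min 1 (exp (- c) / 16) * (R / (r * Q)) powr \<alpha>"
      using r Q by (simp add: c'_def powr_mult[symmetric] mult.commute)
    show ?thesis
    proof (cases "R / (r * Q) \<le> 1")
      case True
      have "min 1 (exp (- c) / 16) * (R / (r * Q)) powr \<alpha> \<le> 1 * 1"
        using True r Q \<alpha> by (intro mult_mono powr_le1) auto
      moreover have "x \<in> ball x R \<inter> E" using r x by simp
      then have "1 \<le> covering_number r (ball x R \<inter> E)"
        using r(1) by (intro covering_number_ge_1 bounded_ball_Int_E) blast+
      ultimately show ?thesis unfolding eq by simp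
    next
      case False
      then have big: "r * Q < R" using r Q by (simp add: field_simps)
      have "1 \<le> 2 / R" using r by (simp add: field_simps)
      then obtain j where j: "M j \<le> 2 / R" "2 / R < M (Suc j)" using ex_scale by blast
      have "r * real L \<le> r * Q"
        unfolding Q_def using r L self_le_power[of "real L" 3]
        by (intro mult_left_mono) (auto intro: order_trans[of _ "real L ^ 3"])
      then have "r * real L \<le> 1" using big r by linarith
      then have "1 \<le> 1 / (r * real L)" using r L by (simp add: field_simps)
      then obtain k' where k': "M k' \<le> 1 / (r * real L)" "1 / (r * real L) < M (Suc k')"
        using ex_scale by blast
      let ?k = "Suc j"
      have Mk: "M ?k \<le> real L * (2 / R)"
        using M_Suc_le[of j] mult_left_mono[OF j(1), of "real L"] by simp
      have "1 / (r * real L) \<le> real L * M k'" using k'(2) M_Suc_le[of k'] by linarith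
      then have Mk': "1 \<le> r * real L * (real L * M k')" using r L by (simp add: field_simps)
      have pos: "M ?k > 0" "M k' > 0" using lev_pos(2) by auto
      have ratio: "R / (r * Q) \<le> M k' / M ?k"
      proof -
        have "R * M ?k \<le> 2 * real L" using Mk r by (simp add: field_simps)
        also have "\<dots> \<le> 2 * real L * (r * real L * (real L * M k'))"
          using mult_left_mono[OF Mk', of "2 * real L"] by simp
        also have "\<dots> = M k' * (r * Q)" by (simp add: Q_def eval_nat_numeral)
        finally show ?thesis using r Q pos by (simp add: field_simps)
      qed
      have "?k \<le> k'"
      proof (rule ccontr)
        assume "\<not> ?k \<le> k'"
        then have "M k' \<le> M ?k" by (intro M_mono) auto
        then have "M k' / M ?k \<le> 1" using pos by simp
        then show False using ratio False by simp
      qed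
      have "r * real L * M k' \<le> 1" using k'(1) r L by (simp add: field_simps)
      moreover have "2 / M ?k < R" using j(2) r pos by (simp add: field_simps)
      ultimately have cov: "Nm ?k k' \<le> 16 * covering_number r (ball x R \<inter> E)"
        using \<open>?k \<le> k'\<close> r by (intro Nm_le_covering_number[OF x]) auto
      have "\<alpha> * h ?k (k' - ?k) - c \<le> gm ?k (k' - ?k)" by (rule c) simp
      then have "\<alpha> * ln (M k' / M ?k) - c \<le> ln (real (Nm ?k k'))"
        using \<open>?k \<le> k'\<close> by (simp add: h_def gm_def)
      moreover have N1: "1 \<le> Nm ?k k'" using \<open>?k \<le> k'\<close> by (intro Nm_bounds) auto
      ultimately have "exp (\<alpha> * ln (M k' / M ?k) - c) \<le> real (Nm ?k k')"
        by (metis exp_le_cancel_iff exp_ln of_nat_0_less_iff less_le_trans zero_less_one)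
      moreover have "exp (\<alpha> * ln (M k' / M ?k) - c) = exp (- c) * (M k' / M ?k) powr \<alpha>"
        using pos by (simp add: powr_def exp_diff exp_minus field_simps)
      moreover have "(R / (r * Q)) powr \<alpha> \<le> (M k' / M ?k) powr \<alpha>"
        using ratio r Q \<alpha> by (intro powr_mono2) auto
      then have "exp (- c) * (R / (r * Q)) powr \<alpha> \<le> exp (- c) * (M k' / M ?k) powr \<alpha>"
        by (intro mult_left_mono) auto
      ultimately have "exp (- c) * (R / (r * Q)) powr \<alpha> \<le> real (16 * covering_number r (ball x R \<inter> E))"
        using cov by linarith
      then have "exp (- c) / 16 * (R / (r * Q)) powr \<alpha> \<le> real (covering_number r (ball x R \<inter> E))"
        by simp
      moreover have "min 1 (exp (- c) / 16) * (R / (r * Q)) powr \<alpha> \<le> exp (- c) / 16 * (R / (r * Q)) powr \<alpha>"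
        by (intro mult_right_mono) auto
      ultimately show ?thesis unfolding eq by linarith
    qed
  qed
  then have "c' * (R / r) powr \<alpha> \<le> (INF x\<in>E. real (covering_number r (ball x R \<inter> E)))"
    if "0 < r" "r < R" "R < 1" for r R
    using that E_nonempty by (intro cINF_greatest) auto
  then show ?thesis unfolding lower_exps_def using \<alpha> c' zero_less_one by blast
qed

text \<open>The exponent is tested on balls around a square that attains \<open>Np\<close>. Initial
  levels are cut off at \<open>k0\<close> by subadditivity; short blocks are absorbed by the a
  priori bound \<open>gp_bounds\<close>.\<close>

lemma assouad_expsD:
  assumes "\<alpha> \<in> assouad_exps"
  shows "\<exists>c. \<forall>k\<ge>1. \<forall>p. gp k p \<le> \<alpha> * h k p + c"
proof -
  obtain b c0 where \<alpha>: "\<alpha> \<ge> 0" and b: "b > 0" "c0 > 0"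
    and up: "\<And>r R. 0 < r \<Longrightarrow> r < R \<Longrightarrow> R < b \<Longrightarrow>
      (SUP x\<in>E. real (covering_number r (ball x R \<inter> E))) \<le> c0 * (R / r) powr \<alpha>"
    using assms unfolding assouad_exps_def by blast
  have L: "1 \<le> real L" using L_ge_2 by simp
  obtain k1 where k1: "3 / b < M k1" using M_unbounded by blast
  define k0 where "k0 = max 1 k1"
  define c1 where "c1 = \<bar>ln (16 * c0)\<bar> + \<alpha> * ln (3 * real L)"
  have large: "gp k p \<le> \<alpha> * h k p + c1" if k: "k \<ge> k0" for k p
  proof -
    have k1': "1 \<le> k" using k by (simp add: k0_def)
    \<comment> \<open>Any constant above 2 works: the radius must strictly exceed
      \<open>2 / M k\<close>.\<close>
    define R where "R = 3 / M k"
    define r where "r = 1 / (real L * M (k + p))"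
    have pos: "R > 0" "r > 0" "M k > 0" "M (k + p) > 0" using L lev_pos(2) by (auto simp: R_def r_def)
    have "M k1 \<le> M k" using k by (intro M_mono) (simp add: k0_def)
    with k1 have "3 / b < M k" by simp
    then have Rb: "R < b" using b pos by (simp add: R_def field_simps)
    have "1 * M k \<le> real L * M (k + p)" using L pos M_mono[of k "k + p"] by (intro mult_mono) auto
    then have "r \<le> 1 / M k" unfolding r_def using pos L by (intro divide_left_mono) auto
    also have "\<dots> < R" using pos by (simp add: R_def divide_strict_right_mono)
    finally have rR: "r < R" .
    have Rr: "R / r = 3 * real L * (M (k + p) / M k)" by (simp add: R_def r_def)
    have lnRr: "ln (R / r) = ln (3 * real L) + h k p"
      unfolding Rr h_def using pos L by (subst ln_mult) auto
    have "r * real L * M (k + p) \<le> 1" using pos L by (simp add: r_def)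
    moreover have "2 / M k < R" using pos by (simp add: R_def divide_strict_right_mono)
    ultimately obtain x where x: "x \<in> E" "Np k (k + p) \<le> 16 * covering_number r (ball x R \<inter> E)"
      using ex_Np_le_covering_number[OF k1' le_add1[of k p] _ pos(2)] by blast
    have "real (covering_number r (ball x R \<inter> E)) \<le> (SUP x\<in>E. real (covering_number r (ball x R \<inter> E)))"
      by (rule cSUP_upper[OF x(1)])
        (auto intro!: bdd_aboveI2[of _ _ "real (covering_number r E)"] covering_number_le_E pos)
    also have "\<dots> \<le> c0 * (R / r) powr \<alpha>" by (rule up[OF pos(2) rR Rb])
    finally have "real (Np k (k + p)) \<le> (16 * c0) * (R / r) powr \<alpha>" using x(2) by linarith
    then have "gp k p \<le> ln ((16 * c0) * (R / r) powr \<alpha>)"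
      unfolding gp_def using b pos Np_bounds(1)[OF k1' le_add1[of k p]] by (subst ln_le_cancel_iff) auto
    also have "\<dots> = ln (16 * c0) + \<alpha> * (ln (3 * real L) + h k p)"
      using b pos by (subst ln_const_powr) (auto simp: lnRr)
    finally show ?thesis by (simp add: c1_def distrib_left)
  qed
  define c2 where "c2 = ln (real L) + 2 * (real k0 * ln (real L))"
  have c1: "c1 \<ge> 0" using \<alpha> L by (simp add: c1_def)
  have c2: "c2 \<ge> 0" using L by (simp add: c2_def)
  have gk: "gp k j \<le> c2" if "j \<le> k0" "k \<ge> 1" for k j
  proof -
    have "real j * ln (real L) \<le> real k0 * ln (real L)" using that L by (intro mult_right_mono) auto
    then show ?thesis using gp_bounds(2)[OF that(2), of j] h_le[of k j] by (simp add: c2_def)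
  qed
  have "gp k p \<le> \<alpha> * h k p + (c1 + c2)" if k: "k \<ge> 1" for k p
  proof -
    consider "k \<ge> k0" | "k \<le> k0" "k0 \<le> k + p" | "k + p \<le> k0" by linarith
    then show ?thesis
    proof cases
      case 1
      then show ?thesis using large[OF 1, of p] c2 by simp
    next
      case 2
      let ?j = "k0 - k" and ?q = "k + p - k0"
      have e: "k + ?j = k0" "?j + ?q = p" using 2 by auto
      have "gp k p \<le> gp k ?j + gp k0 ?q" using gp_subadditive[OF k, of ?j ?q] unfolding e .
      also have "\<dots> \<le> c2 + (\<alpha> * h k0 ?q + c1)" using gk[OF _ k, of ?j] large[of k0 ?q] by simp
      also have "\<alpha> * h k0 ?q \<le> \<alpha> * h k p" using h_le_of_ge[OF 2] \<alpha> by (rule mult_left_mono)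
      finally show ?thesis by simp
    next
      case 3
      then show ?thesis using gk[OF _ k, of p] c1 mult_nonneg_nonneg[OF \<alpha> h_nonneg[of k p]] by simp
    qed
  qed
  then show ?thesis by blast
qed

lemma assouad_expsI:
  assumes \<alpha>: "\<alpha> \<ge> 0" and c: "\<And>k p. k \<ge> 1 \<Longrightarrow> gp k p \<le> \<alpha> * h k p + c"
  shows "\<alpha> \<in> assouad_exps"
proof -
  define Q where "Q = 2 * real L ^ 3"
  define c' where "c' = 16 * exp c * Q powr \<alpha>"
  have L: "1 \<le> real L" using L_ge_2 by simp
  have Q: "Q > 0" using L by (simp add: Q_def)
  have c': "c' > 0" using Q by (simp add: c'_def)
  have "real (covering_number r (ball x R \<inter> E)) \<le> c' * (R / r) powr \<alpha>"
    if r: "0 < r" "r < R" "R < 1 / real L ^ 2" for r R x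
  proof -
    have "R * (real L * real L) < 1" using r(3) L by (simp add: field_simps power2_eq_square)
    then have big: "real L < 1 / (R * real L)" using r L by (simp add: field_simps)
    then have "1 \<le> 1 / (R * real L)" using L by linarith
    then obtain k where k: "M k \<le> 1 / (R * real L)" "1 / (R * real L) < M (Suc k)" using ex_scale by blast
    have "R < 1" using r(3) L by (smt (verit) divide_le_eq_1_pos one_le_power)
    then have "1 \<le> 2 / r" using r by (simp add: field_simps)
    then obtain j where j: "M j \<le> 2 / r" "2 / r < M (Suc j)" using ex_scale by blast
    let ?k' = "Suc j"
    \<comment> \<open>This is the purpose of the threshold \<open>1 / L ^ 2\<close> for
      \<open>R\<close>: then \<open>M (Suc 0) \<le> L < 1 / (R * L)\<close>, so level 0 is not
      selected.\<close>
    have k1: "1 \<le> k"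
    proof (rule ccontr)
      assume "\<not> 1 \<le> k"
      then have "k = 0" by simp
      then have "M (Suc k) \<le> real L" using M_Suc_le[of 0] by simp
      then show False using k(2) big by simp
    qed
    have pos: "M k > 0" "M ?k' > 0" using lev_pos(2) by auto
    have "1 / (R * real L) \<le> 1 / (r * 1)" using r L by (intro divide_left_mono mult_mono) auto
    also have "\<dots> < 2 / r" using r by (simp add: divide_strict_right_mono)
    finally have "M k < M ?k'" using k(1) j(2) by linarith
    then have kk': "k \<le> ?k'" using M_mono[of ?k' k] by linarith
    have "1 / (R * real L) \<le> real L * M k" using k(2) M_Suc_le[of k] by linarith
    then have Mk: "1 \<le> R * real L * (real L * M k)" using r L by (simp add: field_simps)
    have Mk': "M ?k' * r \<le> 2 * real L"
    proof -
      have "M ?k' \<le> real L * (2 / r)" using M_Suc_le[of j] mult_left_mono[OF j(1), of "real L"] by simp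
      then show ?thesis using r by (simp add: field_simps)
    qed
    have ratio: "M ?k' / M k \<le> Q * (R / r)"
    proof -
      have "M ?k' * r \<le> 2 * real L * (R * real L * (real L * M k))"
        using Mk' mult_left_mono[OF Mk, of "2 * real L"] by simp
      also have "\<dots> = Q * R * M k" by (simp add: Q_def eval_nat_numeral)
      finally show ?thesis using r pos by (simp add: field_simps)
    qed
    have N1: "1 \<le> Np k ?k'" using k1 kk' by (rule Np_bounds)
    have "gp k (?k' - k) \<le> \<alpha> * h k (?k' - k) + c" by (rule c[OF k1])
    then have "ln (real (Np k ?k')) \<le> \<alpha> * ln (M ?k' / M k) + c"
      using kk' by (simp add: h_def gp_def)
    then have "real (Np k ?k') \<le> exp (\<alpha> * ln (M ?k' / M k) + c)"
      using N1 by (metis exp_le_cancel_iff exp_ln of_nat_0_less_iff less_le_trans zero_less_one)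
    also have "\<dots> = exp c * (M ?k' / M k) powr \<alpha>" using pos by (simp add: powr_def exp_add)
    also have "\<dots> \<le> exp c * (Q * (R / r)) powr \<alpha>"
      using ratio pos \<alpha> by (intro mult_left_mono powr_mono2) auto
    also have "(Q * (R / r)) powr \<alpha> = Q powr \<alpha> * (R / r) powr \<alpha>"
      by (rule powr_mult)
    finally have "16 * real (Np k ?k') \<le> c' * (R / r) powr \<alpha>" by (simp add: c'_def)
    moreover have "covering_number r (ball x R \<inter> E) \<le> 16 * Np k ?k'"
    proof (rule covering_number_le_Np[OF k1 kk'])
      show "R * real L * M k \<le> 1" using k(1) r L by (simp add: field_simps)
      show "2 / M ?k' \<le> r" using j(2) r pos by (simp add: field_simps)
    qed (use r in auto)
    ultimately show ?thesis by linarith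
  qed
  then have "(SUP x\<in>E. real (covering_number r (ball x R \<inter> E))) \<le> c' * (R / r) powr \<alpha>"
    if "0 < r" "r < R" "R < 1 / real L ^ 2" for r R
    using that E_nonempty by (intro cSUP_least) auto
  moreover have "0 < 1 / real L ^ 2" using L by simp
  ultimately show ?thesis unfolding assouad_exps_def using \<alpha> c' by blast
qed

text \<open>Every block of length \<open>p\<close> achieves the ratio \<open>?a\<close>, and
  superadditivity extends this to all lengths. A shorter remainder loses at most
  \<open>?a * p * ln L\<close>, because \<open>gm\<close> is nonnegative.\<close>

lemma INF_ratio_mem_lower_exps:
  assumes p: "p \<ge> 1"
  shows "(INF k\<in>{1..}. gm k p / h k p) \<in> lower_exps" (is "?a \<in> _")
proof (rule lower_expsI)
  have q: "0 \<le> gm k p / h k p" if "k \<ge> 1" for k using gm_bounds(1)[OF that] h_nonneg by simp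
  show a: "0 \<le> ?a" using q by (intro cINF_greatest) auto
  have "0 < real p * ln 2" using p by simp
  then have hpos: "h k p > 0" for k using h_ge[of p k] by linarith
  show "?a * h k j - ?a * (real p * ln (real L)) \<le> gm k j" if "k \<ge> 1" for k j
  proof (rule superadditive_ratio_bound[where g = gm and h = h, OF p gm_superadditive h_add _ _ that])
    fix k :: nat assume k: "k \<ge> 1"
    have "?a \<le> gm k p / h k p"
      by (rule cINF_lower) (use q k in \<open>auto intro!: bdd_belowI2[of _ 0]\<close>)
    then show "?a * h k p \<le> gm k p" using hpos[of k] by (simp add: field_simps)
  next
    fix k j :: nat assume k: "k \<ge> 1" "j < p"
    have "h k j \<le> real p * ln (real L)"
      using h_le[of k j] k(2) L_ge_2 by (elim order_trans) (auto intro!: mult_right_mono)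
    from mult_left_mono[OF this a] show "?a * h k j - ?a * (real p * ln (real L)) \<le> gm k j"
      using gm_bounds(1)[OF k(1), of j] by linarith
  qed
qed

lemma SUP_ratio_mem_assouad_exps:
  assumes p: "p \<ge> 1"
  shows "(SUP k\<in>{1..}. gp k p / h k p) \<in> assouad_exps" (is "?a \<in> _")
proof (rule assouad_expsI)
  have "1 * ln 2 \<le> real p * ln 2" using p by (intro mult_right_mono) auto
  then have hpos: "h k p \<ge> ln 2" for k using h_ge[of p k] by linarith
  have q: "gp k p / h k p \<le> ln (real L) / ln 2 + 2" if k: "k \<ge> 1" for k
  proof -
    have "0 < h k p" using hpos[of k] ln_gt_zero[of "2::real"] by linarith
    then have "gp k p / h k p \<le> ln (real L) / h k p + 2"
      using gp_bounds(2)[OF k, of p] by (simp add: field_simps)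
    also have "ln (real L) / h k p \<le> ln (real L) / ln 2"
      using hpos[of k] \<open>0 < h k p\<close> L_ge_2 by (intro divide_left_mono mult_pos_pos) auto
    finally show ?thesis by simp
  qed
  have le: "gp k p / h k p \<le> ?a" if "k \<ge> 1" for k
    by (rule cSUP_upper) (use q that in \<open>auto intro!: bdd_aboveI2\<close>)
  have "0 \<le> gp 1 p / h 1 p" using gp_bounds(1)[of 1 p] h_nonneg[of 1 p] by simp
  then show a: "0 \<le> ?a" using le[of 1] by linarith
  let ?c = "ln (real L) + 2 * (real p * ln (real L))"
  show "gp k j \<le> ?a * h k j + ?c" if "k \<ge> 1" for k j
  proof -
    \<comment> \<open>The block argument for \<open>- gp\<close> with slope \<open>- ?a\<close>;
      \<open>?c\<close> bounds \<open>gp\<close> on remainders shorter than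
      \<open>p\<close>.\<close>
    have "(- ?a) * h k j - ?c \<le> - gp k j"
    proof (rule superadditive_ratio_bound[where g = "\<lambda>k j. - gp k j" and h = h, OF p _ h_add _ _ that])
      fix k :: nat assume k: "k \<ge> 1"
      have "0 < h k p" using hpos[of k] ln_gt_zero[of "2::real"] by linarith
      with le[OF k] show "(- ?a) * h k p \<le> - gp k p" by (simp add: field_simps)
      show "- gp k p + - gp (k + p) j \<le> - gp k (p + j)" for j using gp_subadditive[OF k, of p j] by simp
    next
      fix k j :: nat assume k: "k \<ge> 1" "j < p"
      have "h k j \<le> real p * ln (real L)"
        using h_le[of k j] k(2) L_ge_2 by (elim order_trans) (auto intro!: mult_right_mono)
      then show "(- ?a) * h k j - ?c \<le> - gp k j"
        using gp_bounds(2)[OF k(1), of j] mult_nonneg_nonneg[OF a h_nonneg[of k j]] by simp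
    qed
    then show ?thesis by simp
  qed
qed

lemma lower_dimension_limit:
  "(\<lambda>p. INF k\<in>{1..}. gm k p / h k p) \<longlonglongrightarrow> lower_dimension E"
  unfolding lower_dimension_def lower_exps_def[symmetric]
proof (rule INF_ratio_tendsto_Sup[OF _ h_ge _ lower_expsD INF_ratio_mem_lower_exps])
  fix k p :: nat assume k: "k \<ge> 1"
  have "0 \<le> ln (real L)" using L_ge_2 by simp
  then have "0 \<le> ln (real L) * h k p" using h_nonneg by simp
  then show "\<bar>gm k p\<bar> \<le> (ln (real L) + 2) + (ln (real L) + 2) * h k p"
    using gm_bounds[OF k, of p] by (simp add: distrib_right)
qed auto

lemma assouad_dimension_limit:
  "(\<lambda>p. SUP k\<in>{1..}. gp k p / h k p) \<longlonglongrightarrow> assouad_dimension E"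
  unfolding assouad_dimension_def assouad_exps_def[symmetric]
proof (rule SUP_ratio_tendsto_Inf[OF _ h_ge _ assouad_expsD SUP_ratio_mem_assouad_exps])
  fix k p :: nat assume k: "k \<ge> 1"
  have "0 \<le> ln (real L)" using L_ge_2 by simp
  then have "0 \<le> ln (real L) * h k p" using h_nonneg by simp
  then show "\<bar>gp k p\<bar> \<le> (ln (real L) + 2) + (ln (real L) + 2) * h k p"
    using gp_bounds[OF k, of p] by (simp add: distrib_right)
qed auto

end

theorem theorem2p5:
  fixes n m :: "nat \<Rightarrow> nat" and D :: "nat \<Rightarrow> (nat \<times> nat) set"
  assumes "moran_construction n m D"
    and "bdd_above (n ` {1..} \<union> m ` {1..})"
  shows "(\<lambda>p. INF k\<in>{1..}. ln (real (moran_N_minus n m D k (k + p))) /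
                 ln (\<Prod>i=k+1..k+p. real (m i)))
           \<longlonglongrightarrow> lower_dimension (moran_set n m D)
       \<and> (\<lambda>p. SUP k\<in>{1..}. ln (real (moran_N_plus n m D k (k + p))) /
                 ln (\<Prod>i=k+1..k+p. real (m i)))
           \<longlonglongrightarrow> assouad_dimension (moran_set n m D)"
proof -
  obtain L where L: "\<And>x. x \<in> n ` {1..} \<union> m ` {1..} \<Longrightarrow> x \<le> L"
    using assms(2) unfolding bdd_above_def by blast
  have mc: "n k \<ge> 2 \<and> m k \<ge> 2 \<and> D k \<subseteq> {0..n k - 1} \<times> {0..m k - 1} \<and> card (D k) \<ge> 2"
    if "k \<ge> 1" for k using assms(1) that unfolding moran_construction_def by blast
  interpret moran n m D L
  proof
    fix k :: nat assume k: "k \<ge> 1"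
    show "2 \<le> n k \<and> n k \<le> L" "2 \<le> m k \<and> m k \<le> L" using mc[OF k] L k by auto
    show "D k \<subseteq> {0..n k - 1} \<times> {0..m k - 1}" "D k \<noteq> {}" using mc[OF k] by auto
  qed
  \<comment> \<open>\<open>Nm\<close> and \<open>moran_N_minus\<close> are identified only for
    \<open>k < k + p\<close>, so the two sequences are shown to agree from \<open>p = 1\<close> on,
    which suffices for the limit.\<close>
  have "(INF k\<in>{1..}. gm k p / h k p) = (INF k\<in>{1..}. ln (real (moran_N_minus n m D k (k + p))) /
      ln (\<Prod>i=k+1..k+p. real (m i)))" if "p \<ge> 1" for p
    by (rule INF_cong) (use that in \<open>auto simp: gm_def h_eq_prod Nm_eq\<close>)
  then have "\<forall>\<^sub>F p in sequentially. (INF k\<in>{1..}. gm k p / h k p)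
      = (INF k\<in>{1..}. ln (real (moran_N_minus n m D k (k + p))) / ln (\<Prod>i=k+1..k+p. real (m i)))"
    by (rule eventually_sequentiallyI)
  moreover have "(SUP k\<in>{1..}. gp k p / h k p) = (SUP k\<in>{1..}. ln (real (moran_N_plus n m D k (k + p))) /
      ln (\<Prod>i=k+1..k+p. real (m i)))" if "p \<ge> 1" for p
    by (rule SUP_cong) (use that in \<open>auto simp: gp_def h_eq_prod Np_eq\<close>)
  then have "\<forall>\<^sub>F p in sequentially. (SUP k\<in>{1..}. gp k p / h k p)
      = (SUP k\<in>{1..}. ln (real (moran_N_plus n m D k (k + p))) / ln (\<Prod>i=k+1..k+p. real (m i)))"
    by (rule eventually_sequentiallyI)
  ultimately show ?thesis
    using Lim_transform_eventually[OF lower_dimension_limit]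
      Lim_transform_eventually[OF assouad_dimension_limit] by (intro conjI)
qed

end
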